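(* Consider the online case $f(x)=\frac1n\sum_{i=1}^n f_i(x)$, $f_i(x)=\mathbf{E}_{\xi_i\sim\mathcal{D}_i}[f_{\xi_i}(x)]$, $x\in\mathbb{R}^d$. Assume there exists $f_*\in\mathbb{R}$ with $f(x)\ge f_*$ for all $x\in\mathbb{R}^d$; that $f_i$ is $L_i$-smooth for all $i\in\{1,\dots,n\}$, i.e. $\|\nabla f_i(x)-\nabla f_i(y)\|\le L_i\|x-y\|$ for all $x,y\in\mathbb{R}^d$; that the average $\mathcal{L}$-smoothness assumption (see context) holds with constants $\mathcal{L}_i\ge0$; and that for all $i$ there exists $\sigma_i\in[0,+\infty)$ such that for all $x\in\mathbb{R}^d$, $\mathbf{E}_{\xi_i\sim\mathcal{D}_i}[\nabla f_{\xi_i}(x)]=\nabla f_i(x)$ and $\mathbf{E}_{\xi_i\sim\mathcal{D}_i}[\|\nabla f_{\xi_i}(x)-\nabla f_i(x)\|^2]\le\sigma_i^2$. Put $L^2=\frac1n\sum_{i=1}^nL_i^2$, $\mathcal{L}^2=\frac1n\sum_{i=1}^n\mathcal{L}_i^2$, $\sigma^2=\frac1n\sum_{i=1}^n\sigma_i^2$ and $\Delta_0=f(x^0)-f_*$. Let $\mathcal{Q}$ be a quantization operator with parameter $\omega$ and expected density $\zeta_{\mathcal Q}$, and let $p=\min\left\{\frac{\zeta_{\mathcal Q}}{d},\frac{b'}{b+b'}\right\}$, where $b'\le b$ and $b=\Theta\left(\frac{\sigma^2}{n\varepsilon^2}\right)$. If $$\gamma\le\frac{1}{L+\sqrt{\frac{\max\{d/\zeta_{\mathcal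 Q}-1,\,b/b'\}}{n}\left(\omega L^2+\frac{(1+\omega)\mathcal{L}^2}{b'}\right)}},$$ then VR-MARINA (online case) requires $$\mathcal{O}\left(\max\left\{\frac{d}{\zeta_{\mathcal Q}},\frac{\sigma^2}{nb'\varepsilon^2}\right\}+\frac{\Delta_0}{\varepsilon^2}\left(L\left(1+\sqrt{\frac\omega n\max\left\{\frac d{\zeta_{\mathcal Q}}-1,\frac{\sigma^2}{nb'\varepsilon^2}\right\}}\right)+\mathcal{L}\sqrt{\frac{1+\omega}{nb'}\max\left\{\frac d{\zeta_{\mathcal Q}}-1,\frac{\sigma^2}{nb'\varepsilon^2}\right\}}\right)\right)$$ iterations/communication rounds and $$\mathcal{O}\left(\max\left\{\frac{db'}{\zeta_{\mathcal Q}},\frac{\sigma^2}{n\varepsilon^2}\right\}+\frac{\Delta_0Lb'}{\varepsilon^2}+\frac{\Delta_0L}{\varepsilon^2}\sqrt{\frac{\omega b'}{n}\max\left\{\left(\frac d{\zeta_{\mathcal Q}}-1\right)b',\frac{\sigma^2}{n\varepsilon^2}\right\}}+\frac{\Delta_0\mathcal{L}}{\varepsilon^2}\sqrt{\frac{1+\omega}{n}\max\left\{\left(\frac d{\zeta_{\mathcal Q}}-1\right)b',\frac{\sigma^2}{n\varepsilon^2}\right\}}\right)$$ stochastic oracle calls per node in expectation to achieve $\mathbf{E}[\|\nabla f(\hat x^K)\|^2]\le\varepsilon^2$, and the expected total communication cost per worker is $$\mathcal{O}\left(\max\left\{d,\frac{\sigma^2\zeta_{\mathcal Q}}{nb'\varepsilon^2}\right\}+\frac{\Delta_0\zeta_{\mathcal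 Q}}{\varepsilon^2}\left(L\left(1+\sqrt{\frac\omega n\max\left\{\frac d{\zeta_{\mathcal Q}}-1,\frac{\sigma^2}{nb'\varepsilon^2}\right\}}\right)+\mathcal{L}\sqrt{\frac{1+\omega}{nb'}\max\left\{\frac d{\zeta_{\mathcal Q}}-1,\frac{\sigma^2}{nb'\varepsilon^2}\right\}}\right)\right)$$ under an assumption that the communication cost is proportional to the number of non-zero components of transmitted vectors from workers to the server.
   Context: $\|\cdot\|$ is the Euclidean norm; $\|y\|_0$ is the number of non-zero components of $y\in\mathbb{R}^d$. Quantization operator: a stochastic mapping $\mathcal{Q}:\mathbb{R}^d\to\mathbb{R}^d$ for which there is $\omega>0$ with $\mathbf{E}[\mathcal{Q}(x)]=x$ and $\mathbf{E}[\|\mathcal{Q}(x)-x\|^2]\le\omega\|x\|^2$ for any $x\in\mathbb{R}^d$. Its expected density is $\zeta_{\mathcal Q}=\sup_{x\in\mathbb{R}^d}\mathbf{E}[\|\mathcal{Q}(x)\|_0]$. VR-MARINA, online case (a distributed method with $n$ workers and a server; input: starting point $x^0$, stepsize $\gamma$, minibatch sizes $b,b'$, probability $p\in(0,1]$, number of iterations $K$): initialize $g^0=\frac1{nb}\sum_{i=1}^n\sum_{j\in I_{i,0}}\nabla f_{\xi_{ij}^0}(x^0)$, where $I_{i,0}$ is the set of the indices in the minibatch, $|I_{i,0}|=b$. For $k=0,\dots,K-1$: sample $c_k\sim\mathrm{Bernoulli}(p)$ and broadcast $g^k$ to all workers; each worker $i=1,\dots,n$ in parallel computes $x^{k+1}=x^k-\gamma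 g^k$ and sets $g_i^{k+1}=\frac1b\sum_{j\in I_{i,k}}\nabla f_{\xi_{ij}^k}(x^{k+1})$ if $c_k=1$, and $g_i^{k+1}=g^k+\mathcal{Q}(\widetilde\Delta_i^k)$ if $c_k=0$, where $\widetilde\Delta_i^k=\frac1{b'}\sum_{j\in I'_{i,k}}(\nabla f_{\xi_{ij}^k}(x^{k+1})-\nabla f_{\xi_{ij}^k}(x^k))$ and $I_{i,k},I'_{i,k}$ are the sets of the indices in the minibatches, $|I_{i,k}|=b$, $|I'_{i,k}|=b'$; then $g^{k+1}=\frac1n\sum_{i=1}^n g_i^{k+1}$. Here the $\xi_{ij}^k$ are independently sampled from $\mathcal{D}_i$. Return $\hat x^K$ chosen uniformly at random from $\{x^k\}_{k=0}^{K-1}$. Average $\mathcal{L}$-smoothness: for all $k\ge0$ and $i\in\{1,\dots,n\}$, with $\Delta_i^k=\nabla f_i(x^{k+1})-\nabla f_i(x^k)$, one has $\mathbf{E}[\widetilde\Delta_i^k\mid x^k,x^{k+1}]=\Delta_i^k$ and $\mathbf{E}[\|\widetilde\Delta_i^k-\Delta_i^k\|^2\mid x^k,x^{k+1}]\le\frac{\mathcal{L}_i^2}{b'}\|x^{k+1}-x^k\|^2$ with some $\mathcal{L}_i\ge0$. A stochastic oracle call is the computation of one stochastic gradient $\nabla f_{\xi}$ at one point.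
   Formalization: The stepsize is positive and the O-constants depend on a lower bound of the ratio of γ to its maximal admissible value (no bound holds uniformly as γ→0); b=Θ(σ²/(nε²)) is taken with lower constant greater than 1, since otherwise the residual σ²/(nb) can exceed ε². *)

theory Defs
  imports "HOL-Probability.Probability"
begin

definition grad :: "(real ^ 'd::finite \<Rightarrow> real) \<Rightarrow> real ^ 'd \<Rightarrow> real ^ 'd" where
  "grad f x = (THE v. GDERIV f x :> v)"

definition smooth :: "real \<Rightarrow> (real ^ 'd::finite \<Rightarrow> real) \<Rightarrow> bool" where
  "smooth L f \<longleftrightarrow> (\<forall>x. f differentiable (at x)) \<and>
     (\<forall>x y. norm (grad f x - grad f y) \<le> L * norm (x - y))"

definition nnz :: "real ^ 'd::finite \<Rightarrow> nat" where
  "nnz y = card {j. y $ j \<noteq> 0}"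

text \<open>The Bochner integral of a non-integrable function is \<^term>\<open>0\<close>, so integrability is
  part of every bound on an expectation.\<close>

definition expectation_le :: "'m measure \<Rightarrow> ('m \<Rightarrow> real) \<Rightarrow> real \<Rightarrow> bool" where
  "expectation_le M X c \<longleftrightarrow> integrable M X \<and> integral\<^sup>L M X \<le> c"

text \<open>A stochastic mapping is a measurable function of its argument and of a random seed with law
  \<open>N\<close>; every use of the mapping draws a fresh seed.\<close>

definition quantization_operator ::
    "'q measure \<Rightarrow> ('q \<Rightarrow> real ^ 'd::finite \<Rightarrow> real ^ 'd) \<Rightarrow> real \<Rightarrow> bool" where
  "quantization_operator N \<Q> \<omega> \<longleftrightarrow>
     prob_space N \<and> (\<lambda>(s, x). \<Q> s x) \<in> borel_measurable (N \<Otimes>\<^sub>M borel) \<and> \<omega> > 0 \<and>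
     (\<forall>x. has_bochner_integral N (\<lambda>s. \<Q> s x) x \<and>
          expectation_le N (\<lambda>s. (norm (\<Q> s x - x))\<^sup>2) (\<omega> * (norm x)\<^sup>2))"

definition expected_density ::
    "'q measure \<Rightarrow> ('q \<Rightarrow> real ^ 'd::finite \<Rightarrow> real ^ 'd) \<Rightarrow> real" where
  "expected_density N \<Q> = (SUP x. \<integral>s. real (nnz (\<Q> s x)) \<partial>N)"

definition minibatch_grad ::
    "('z \<Rightarrow> real ^ 'd::finite \<Rightarrow> real) \<Rightarrow> (nat \<Rightarrow> 'z) \<Rightarrow> nat \<Rightarrow> real ^ 'd \<Rightarrow> real ^ 'd" where
  "minibatch_grad F z m x = (1 / real m) *\<^sub>R (\<Sum>j<m. grad (F (z j)) x)"

definition minibatch_grad_diff ::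
    "('z \<Rightarrow> real ^ 'd::finite \<Rightarrow> real) \<Rightarrow> (nat \<Rightarrow> 'z) \<Rightarrow> nat \<Rightarrow> real ^ 'd \<Rightarrow> real ^ 'd \<Rightarrow> real ^ 'd"
  where
  "minibatch_grad_diff F z m y x = (1 / real m) *\<^sub>R (\<Sum>j<m. grad (F (z j)) y - grad (F (z j)) x)"

text \<open>Workers are \<open>i < n\<close>. The samples \<open>\<xi> 0 i j\<close> are those of the initialization and
  \<open>\<xi> (Suc k) i j\<close> those of iteration \<open>k\<close>, so that iteration \<open>0\<close> does not reuse the initial
  minibatch. The random seed used by worker \<open>i\<close> in iteration \<open>k\<close> is \<open>q k i\<close>.\<close>

datatype source = Sample nat nat nat | Coin nat | Seed nat nat

definition independent_sources ::
    "'m measure \<Rightarrow> nat \<Rightarrow> nat \<Rightarrow> (nat \<Rightarrow> 'z measure) \<Rightarrow> 'q measure \<Rightarrow> real \<Rightarrow>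
     (nat \<Rightarrow> nat \<Rightarrow> nat \<Rightarrow> 'm \<Rightarrow> 'z) \<Rightarrow> (nat \<Rightarrow> 'm \<Rightarrow> bool) \<Rightarrow> (nat \<Rightarrow> nat \<Rightarrow> 'm \<Rightarrow> 'q) \<Rightarrow> bool" where
  "independent_sources M n b \<D> N p \<xi> c q \<longleftrightarrow>
     prob_space M \<and>
     (\<forall>k. \<forall>i<n. \<forall>j<b. \<xi> k i j \<in> M \<rightarrow>\<^sub>M \<D> i \<and> distr M (\<D> i) (\<xi> k i j) = \<D> i) \<and>
     (\<forall>k. c k \<in> M \<rightarrow>\<^sub>M count_space UNIV \<and>
          distr M (count_space UNIV) (c k) = measure_pmf (bernoulli_pmf p)) \<and>
     (\<forall>k. \<forall>i<n. q k i \<in> M \<rightarrow>\<^sub>M N \<and> distr M N (q k i) = N) \<and>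
     prob_space.indep_sets M
       (\<lambda>s. case s of
          Sample k i j \<Rightarrow> sets (vimage_algebra (space M) (\<xi> k i j) (\<D> i))
        | Coin k \<Rightarrow> sets (vimage_algebra (space M) (c k) (count_space UNIV))
        | Seed k i \<Rightarrow> sets (vimage_algebra (space M) (q k i) N))
       ({Sample k i j | k i j. i < n \<and> j < b} \<union> range Coin \<union> {Seed k i | k i. i < n})"

text \<open>\<open>x k\<close>, \<open>g k\<close>, \<open>gw k i\<close> and \<open>\<Delta> k i\<close> are the iterate, the server's gradient estimator, the
  estimator of worker \<open>i\<close> and its minibatch gradient difference.\<close>

definition vr_marina_online ::
    "nat \<Rightarrow> nat \<Rightarrow> nat \<Rightarrow> real \<Rightarrow> real ^ 'd::finite \<Rightarrow> (nat \<Rightarrow> 'z \<Rightarrow> real ^ 'd \<Rightarrow> real) \<Rightarrow>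
     ('q \<Rightarrow> real ^ 'd \<Rightarrow> real ^ 'd) \<Rightarrow>
     (nat \<Rightarrow> nat \<Rightarrow> nat \<Rightarrow> 'm \<Rightarrow> 'z) \<Rightarrow> (nat \<Rightarrow> 'm \<Rightarrow> bool) \<Rightarrow> (nat \<Rightarrow> nat \<Rightarrow> 'm \<Rightarrow> 'q) \<Rightarrow>
     (nat \<Rightarrow> 'm \<Rightarrow> real ^ 'd) \<Rightarrow> (nat \<Rightarrow> 'm \<Rightarrow> real ^ 'd) \<Rightarrow>
     (nat \<Rightarrow> nat \<Rightarrow> 'm \<Rightarrow> real ^ 'd) \<Rightarrow> (nat \<Rightarrow> nat \<Rightarrow> 'm \<Rightarrow> real ^ 'd) \<Rightarrow> bool" where
  "vr_marina_online n b b' \<gamma> x0 F \<Q> \<xi> c q x g gw \<Delta> \<longleftrightarrow>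
     (\<forall>w. x 0 w = x0) \<and>
     (\<forall>w. \<forall>i<n. gw 0 i w = minibatch_grad (F i) (\<lambda>j. \<xi> 0 i j w) b x0) \<and>
     (\<forall>k w. g k w = (1 / real n) *\<^sub>R (\<Sum>i<n. gw k i w)) \<and>
     (\<forall>k w. x (Suc k) w = x k w - \<gamma> *\<^sub>R g k w) \<and>
     (\<forall>k w. \<forall>i<n. \<Delta> k i w =
        minibatch_grad_diff (F i) (\<lambda>j. \<xi> (Suc k) i j w) b' (x (Suc k) w) (x k w)) \<and>
     (\<forall>k w. \<forall>i<n. gw (Suc k) i w =
        (if c k w then minibatch_grad (F i) (\<lambda>j. \<xi> (Suc k) i j w) b (x (Suc k) w)
         else g k w + \<Q> (q k i w) (\<Delta> k i w)))"

text \<open>The output of \<open>K\<close> iterations lives on the product of the run's probability space with the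
  uniform distribution of the output index.\<close>

definition output_space :: "'m measure \<Rightarrow> nat \<Rightarrow> ('m \<times> nat) measure" where
  "output_space M K = M \<Otimes>\<^sub>M measure_pmf (pmf_of_set {..<K})"

definition output_point :: "(nat \<Rightarrow> 'm \<Rightarrow> real ^ 'd) \<Rightarrow> 'm \<times> nat \<Rightarrow> real ^ 'd" where
  "output_point x = (\<lambda>(w, k). x k w)"

text \<open>Componentwise conditional expectation of a random vector.\<close>

definition vec_cond_exp ::
    "'m measure \<Rightarrow> 'm measure \<Rightarrow> ('m \<Rightarrow> real ^ 'd::finite) \<Rightarrow> 'm \<Rightarrow> real ^ 'd" where
  "vec_cond_exp M G X w = (\<chi> j. real_cond_exp M G (\<lambda>v. X v $ j) w)"

text \<open>The conditional second moment is taken in \<^typ>\<open>ennreal\<close>, where it does not depend on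
  integrability.\<close>

definition average_smooth ::
    "'m measure \<Rightarrow> nat \<Rightarrow> nat \<Rightarrow> (nat \<Rightarrow> real ^ 'd::finite \<Rightarrow> real) \<Rightarrow> (nat \<Rightarrow> 'm \<Rightarrow> real ^ 'd) \<Rightarrow>
     (nat \<Rightarrow> nat \<Rightarrow> 'm \<Rightarrow> real ^ 'd) \<Rightarrow> (nat \<Rightarrow> real) \<Rightarrow> bool" where
  "average_smooth M n b' f x \<Delta> \<L> \<longleftrightarrow> (\<forall>k. \<forall>i<n. \<L> i \<ge> 0 \<and>
     (let G = vimage_algebra (space M) (\<lambda>w. (x k w, x (Suc k) w)) borel;
          \<delta> = (\<lambda>w. grad (f i) (x (Suc k) w) - grad (f i) (x k w))
      in (AE w in M. vec_cond_exp M G (\<Delta> k i) w = \<delta> w) \<and>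
         (AE w in M. nn_cond_exp M G (\<lambda>v. ennreal ((norm (\<Delta> k i v - \<delta> v))\<^sup>2)) w
            \<le> ennreal ((\<L> i)\<^sup>2 / real b' * (norm (x (Suc k) w - x k w))\<^sup>2))))"

text \<open>Stochastic gradients computed by one worker in \<open>K\<close> iterations: \<open>b\<close> for the initialization,
  then \<open>b\<close> at \<open>x (Suc k)\<close>, or \<open>b'\<close> at each of the two points \<open>x (Suc k)\<close> and \<open>x k\<close>.\<close>

definition oracle_calls :: "nat \<Rightarrow> nat \<Rightarrow> (nat \<Rightarrow> 'm \<Rightarrow> bool) \<Rightarrow> nat \<Rightarrow> 'm \<Rightarrow> real" where
  "oracle_calls b b' c K w = real b + (\<Sum>k<K. if c k w then real b else 2 * real b')"

text \<open>Vectors sent to the server by worker \<open>i\<close>: its initial minibatch gradient, then in iteration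
  \<open>k\<close> either the new minibatch gradient or only the quantized difference, since the server
  already knows \<open>g k\<close>.\<close>

definition communication_cost ::
    "(real ^ 'd::finite \<Rightarrow> real) \<Rightarrow> ('q \<Rightarrow> real ^ 'd \<Rightarrow> real ^ 'd) \<Rightarrow> (nat \<Rightarrow> 'm \<Rightarrow> bool) \<Rightarrow>
     (nat \<Rightarrow> nat \<Rightarrow> 'm \<Rightarrow> 'q) \<Rightarrow> (nat \<Rightarrow> nat \<Rightarrow> 'm \<Rightarrow> real ^ 'd) \<Rightarrow> (nat \<Rightarrow> nat \<Rightarrow> 'm \<Rightarrow> real ^ 'd) \<Rightarrow>
     nat \<Rightarrow> nat \<Rightarrow> 'm \<Rightarrow> real" where
  "communication_cost cost \<Q> c q gw \<Delta> i K w =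
     cost (gw 0 i w) +
     (\<Sum>k<K. cost (if c k w then gw (Suc k) i w else \<Q> (q k i w) (\<Delta> k i w)))"

text \<open>The constant hidden in the three complexity bounds. It is explicit because the dimension is a
  type variable: a constant quantified inside the theorem could depend on the dimension.
  Here \<open>c1\<close> and \<open>c2\<close> are the constants in \<open>b = \<Theta>(\<sigma>\<^sup>2 / (n \<epsilon>\<^sup>2))\<close>, and \<open>\<tau>\<close> bounds from below the
  ratio of the stepsize to its largest admissible value (no bound on the number of iterations
  holds for all stepsizes up to that value). The error after \<open>K\<close> iterations is at most
  \<open>2 \<Delta>\<^sub>0 / (\<gamma> K) + \<sigma>\<^sup>2 / (n b) (1 + 1 / (p K))\<close>, so \<open>c1 > 1\<close> is needed for the residual
  \<open>\<sigma>\<^sup>2 / (n b)\<close> to be below \<open>\<epsilon>\<^sup>2\<close>.\<close>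

definition bigO_const :: "real \<Rightarrow> real \<Rightarrow> real \<Rightarrow> real" where
  "bigO_const c1 c2 \<tau> = 16 * c1 * c2 / ((c1 - 1) * \<tau>)"

end

theory Submission
  imports Defs
begin

text \<open>Write \<open>e k = g k - \<nabla>f (x k)\<close>. Smoothness gives the descent inequality
  \<open>f (x (k+1)) \<le> f (x k) - \<gamma>/2 \<parallel>\<nabla>f (x k)\<parallel>\<^sup>2 - \<gamma>/2 (1 - L \<gamma>) \<parallel>g k\<parallel>\<^sup>2 + \<gamma>/2 \<parallel>e k\<parallel>\<^sup>2\<close>. The errors satisfy
  \<open>E \<parallel>e (k+1)\<parallel>\<^sup>2 \<le> p \<sigma>\<^sup>2/(n b) + (1 - p) (E \<parallel>e k\<parallel>\<^sup>2 + W \<gamma>\<^sup>2 E \<parallel>g k\<parallel>\<^sup>2)\<close> with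
  \<open>W = (\<omega> L\<^sup>2 + (1 + \<omega>) \<L>\<^sup>2 / b') / n\<close>, because each fresh source of randomness contributes a term that
  is centred given all the other sources, so that all cross terms vanish. Integrating out one
  source at a time replaces conditioning on the past by Fubini's theorem. Summing both
  inequalities, the stepsize condition \<open>L \<gamma> + (1 - p)/p W \<gamma>\<^sup>2 \<le> 1\<close> cancels the terms \<open>E \<parallel>g k\<parallel>\<^sup>2\<close> and
  the mean of \<open>E \<parallel>\<nabla>f (x k)\<parallel>\<^sup>2\<close> over \<open>k < K\<close> is at most
  \<open>2 \<Delta>0 / (\<gamma> K) + \<sigma>\<^sup>2/(n b) (1 + 1/(p K))\<close>. The choice of \<open>p\<close> gives
  \<open>(1 - p)/p = max (d/\<zeta> - 1) (b/b')\<close>, and makes a round cost at most \<open>2 \<zeta>\<close> expected components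
  and \<open>3 b'\<close> expected oracle calls.\<close>

subsection \<open>Gradients\<close>

text \<open>Two obstacles shape the development. Stochastic gradients are evaluated at random
  iterates, so measurability in the sample at each fixed point does not suffice; continuity in the
  point upgrades it to joint measurability, and the gradient inherits it as a limit of difference
  quotients. And the vanishing of cross terms must cover workers that act in the same round, not
  only past against present. Therefore no filtration is used: a fresh source is tested against any
  factor measurable with respect to a set of sources that omits it, be it the past error or the
  current message of another worker. Every quantity must be known to be square integrable before its
  integral carries information. The same freezing of the other sources, done in
  \<open>ennreal\<close>, supplies this, and Lipschitz gradients propagate it along the run. The
  ratio \<open>(1 - p)/p\<close> appears because the error recursion contracts by
  \<open>1 - p\<close>, so that its sum is controlled only up to a factor \<open>1/p\<close>. The
  stepsize bound degenerates when its denominator is 0. Then \<open>L = 0\<close>, boundedness below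
  makes the gradient of \<open>f\<close> vanish, and one iteration suffices.\<close>

lemma GDERIV_unique:
  fixes f :: "'a::real_inner \<Rightarrow> real"
  assumes "GDERIV f x :> u" "GDERIV f x :> v"
  shows "u = v"
proof -
  have "(\<lambda>h. h \<bullet> u) = (\<lambda>h. h \<bullet> v)"
    using assms unfolding gderiv_def by (rule has_derivative_unique)
  then have "(u - v) \<bullet> u = (u - v) \<bullet> v" by (rule fun_cong)
  then have "(u - v) \<bullet> (u - v) = 0" by (simp add: inner_diff_right)
  then show ?thesis by simp
qed

lemma grad_eqI: "GDERIV f x :> v \<Longrightarrow> grad f x = v"
  unfolding grad_def by (blast intro: GDERIV_unique)

lemma GDERIV_grad:
  fixes f :: "real ^ 'd::finite \<Rightarrow> real"
  assumes "f differentiable (at x)"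
  shows "GDERIV f x :> grad f x"
proof -
  obtain f' where f': "(f has_derivative f') (at x)"
    using assms unfolding differentiable_def by blast
  then interpret linear f' by (rule has_derivative_linear)
  have "f' h = h \<bullet> (\<Sum>b\<in>Basis. f' b *\<^sub>R b)" for h
  proof -
    have "f' h = f' (\<Sum>b\<in>Basis. (h \<bullet> b) *\<^sub>R b)" by (simp add: euclidean_representation)
    also have "\<dots> = (\<Sum>b\<in>Basis. (h \<bullet> b) * f' b)" by (simp add: sum scale)
    finally show ?thesis by (simp add: inner_sum_right mult.commute)
  qed
  then have "f' = (\<lambda>h. h \<bullet> (\<Sum>b\<in>Basis. f' b *\<^sub>R b))" by (rule ext)
  with f' have "GDERIV f x :> (\<Sum>b\<in>Basis. f' b *\<^sub>R b)"
    unfolding gderiv_def by (rule back_subst[of "\<lambda>u. (f has_derivative u) (at x)"])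
  with grad_eqI show ?thesis by metis
qed

lemma DERIV_along_line:
  fixes f :: "real ^ 'd::finite \<Rightarrow> real"
  assumes "f differentiable (at (x + t *\<^sub>R v))"
  shows "((\<lambda>t. f (x + t *\<^sub>R v)) has_real_derivative v \<bullet> grad f (x + t *\<^sub>R v)) (at t)"
proof -
  have "((\<lambda>t. x + t *\<^sub>R v) has_derivative (\<lambda>h. h *\<^sub>R v)) (at t)"
    by (auto intro!: derivative_eq_intros)
  from has_derivative_compose[OF this GDERIV_grad[OF assms, unfolded gderiv_def]]
  show ?thesis by (simp add: has_field_derivative_def mult.commute[of _ "v \<bullet> _"])
qed

text \<open>The left side minus the right side, taken along the segment from \<open>x\<close> to
  \<open>x + v\<close>, is a function of \<open>t\<close> whose derivative is at most 0 for
  \<open>t \<ge> 0\<close>, by Cauchy-Schwarz and the Lipschitz bound. This avoids integrating the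
  gradient.\<close>

lemma smooth_quadratic_upper_bound:
  fixes f :: "real ^ 'd::finite \<Rightarrow> real"
  assumes "smooth L f"
  shows "f (x + v) \<le> f x + v \<bullet> grad f x + L / 2 * (norm v)\<^sup>2"
proof -
  let ?\<phi> = "\<lambda>t. f (x + t *\<^sub>R v) - t * (v \<bullet> grad f x) - L / 2 * t\<^sup>2 * (norm v)\<^sup>2"
  let ?\<phi>' = "\<lambda>t. v \<bullet> grad f (x + t *\<^sub>R v) - v \<bullet> grad f x - L * t * (norm v)\<^sup>2"
  have der: "(?\<phi> has_real_derivative ?\<phi>' t) (at t)" for t
    by (rule derivative_eq_intros DERIV_along_line refl | use assms in \<open>simp add: smooth_def\<close>)+
  have nonpos: "?\<phi>' t \<le> 0" if "0 \<le> t" for t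
  proof -
    have "v \<bullet> (grad f (x + t *\<^sub>R v) - grad f x) \<le> norm v * norm (grad f (x + t *\<^sub>R v) - grad f x)"
      by (rule norm_cauchy_schwarz)
    also have "\<dots> \<le> norm v * (L * norm (x + t *\<^sub>R v - x))"
      using assms unfolding smooth_def by (intro mult_left_mono norm_ge_zero) blast
    also have "\<dots> = L * t * (norm v)\<^sup>2"
      using that by (simp add: power2_eq_square)
    finally show ?thesis by (simp add: inner_diff_right)
  qed
  have "?\<phi> 1 \<le> ?\<phi> 0"
    by (rule DERIV_nonpos_imp_nonincreasing[where f = "?\<phi>"])
      (use der nonpos in \<open>blast intro: zero_le_one\<close>)+
  then show ?thesis by simp
qed

lemma descent_step:
  fixes f :: "real ^ 'd::finite \<Rightarrow> real"
  assumes "smooth L f"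
  shows "f (x - \<gamma> *\<^sub>R g) \<le> f x - \<gamma> / 2 * (norm (grad f x))\<^sup>2
           - (\<gamma> / 2) * (1 - L * \<gamma>) * (norm g)\<^sup>2 + \<gamma> / 2 * (norm (g - grad f x))\<^sup>2"
proof -
  have 1: "(norm (g - grad f x))\<^sup>2 = (norm g)\<^sup>2 - 2 * (g \<bullet> grad f x) + (norm (grad f x))\<^sup>2"
    by (simp add: power2_norm_eq_inner inner_diff_left inner_diff_right inner_commute)
  have 2: "(norm (- \<gamma> *\<^sub>R g))\<^sup>2 = \<gamma>\<^sup>2 * (norm g)\<^sup>2" by (simp add: power_mult_distrib)
  show ?thesis
    using smooth_quadratic_upper_bound[OF assms, of x "- \<gamma> *\<^sub>R g"] unfolding 1 2
    by (simp add: field_simps power2_eq_square)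
qed

text \<open>For \<open>L = 0\<close> the quadratic upper bound is affine, so a nonzero gradient
  would drive \<open>f\<close> to minus infinity along the steepest descent ray. This settles the
  case where the denominator of the stepsize bound vanishes.\<close>

lemma smooth_zero_bounded_below:
  fixes f :: "real ^ 'd::finite \<Rightarrow> real"
  assumes "smooth 0 f" and lower: "\<And>y. f y \<ge> c"
  shows "grad f x = 0"
proof (rule ccontr)
  assume "grad f x \<noteq> 0"
  then have pos: "(norm (grad f x))\<^sup>2 > 0" by simp
  \<comment> \<open>The length at which the affine bound equals \<open>c - 1\<close>.\<close>
  define t where "t = (f x - c + 1) / (norm (grad f x))\<^sup>2"
  have "f (x - t *\<^sub>R grad f x) \<le> f x - t * (norm (grad f x))\<^sup>2"
    using smooth_quadratic_upper_bound[OF assms(1), of x "- t *\<^sub>R grad f x"]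
    by (simp add: power2_norm_eq_inner)
  with lower[of "x - t *\<^sub>R grad f x"] pos show False by (simp add: t_def)
qed

text \<open>The triangle inequality gives the arithmetic mean of the \<open>Li i\<close> as a
  Lipschitz constant, and Cauchy-Schwarz bounds it by the quadratic mean that defines
  \<open>L\<close>.\<close>

lemma smooth_average:
  fixes fi :: "nat \<Rightarrow> real ^ 'd::finite \<Rightarrow> real"
  assumes n: "n \<ge> 1" and f: "\<And>y. f y = (1 / real n) * (\<Sum>i<n. fi i y)"
    and smooth: "\<And>i. i < n \<Longrightarrow> smooth (Li i) (fi i)"
  shows "grad f y = (1 / real n) *\<^sub>R (\<Sum>i<n. grad (fi i) y)"
    and "smooth (sqrt ((1 / real n) * (\<Sum>i<n. (Li i)\<^sup>2))) f"
proof -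
  have D: "GDERIV f y :> (1 / real n) *\<^sub>R (\<Sum>i<n. grad (fi i) y)" for y
  proof -
    have fi: "(fi i has_derivative (\<lambda>h. h \<bullet> grad (fi i) y)) (at y)" if "i < n" for i
      using GDERIV_grad smooth[OF that] unfolding smooth_def gderiv_def by blast
    have "((\<lambda>y. (1 / real n) * (\<Sum>i<n. fi i y)) has_derivative
        (\<lambda>h. (1 / real n) * (\<Sum>i<n. h \<bullet> grad (fi i) y))) (at y)"
      by (intro has_derivative_mult_right has_derivative_sum fi) simp
    then show ?thesis by (simp add: gderiv_def f[abs_def] inner_sum_right)
  qed
  show grad: "grad f y = (1 / real n) *\<^sub>R (\<Sum>i<n. grad (fi i) y)" for y
    by (rule grad_eqI[OF D])
  have "norm (grad f y - grad f z) \<le> sqrt ((1 / real n) * (\<Sum>i<n. (Li i)\<^sup>2)) * norm (y - z)" for y z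
  proof -
    have "norm (grad f y - grad f z) = (1 / real n) * norm (\<Sum>i<n. grad (fi i) y - grad (fi i) z)"
      by (simp add: grad scaleR_diff_right[symmetric] sum_subtractf[symmetric])
    also have "\<dots> \<le> (1 / real n) * (\<Sum>i<n. Li i * norm (y - z))"
      using smooth unfolding smooth_def by (intro mult_left_mono sum_norm_le) auto
    also have "\<dots> = ((1 / real n) * (\<Sum>i<n. Li i)) * norm (y - z)"
      by (simp add: sum_distrib_right)
    also have "\<dots> \<le> sqrt ((1 / real n) * (\<Sum>i<n. (Li i)\<^sup>2)) * norm (y - z)"
    proof (intro mult_right_mono real_le_rsqrt)
      have "(\<Sum>i<n. Li i)\<^sup>2 \<le> real n * (\<Sum>i<n. (Li i)\<^sup>2)"
        using sum_squared_le_sum_of_squares[of Li "{..<n}"] by (simp add: mult.commute[of _ "real n"])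
      then show "((1 / real n) * (\<Sum>i<n. Li i))\<^sup>2 \<le> (1 / real n) * (\<Sum>i<n. (Li i)\<^sup>2)"
        using n by (simp add: power_mult_distrib power_divide divide_simps power2_eq_square mult_ac)
    qed simp
    finally show ?thesis .
  qed
  moreover have "f differentiable (at y)" for y
    using D[of y] unfolding gderiv_def differentiable_def by blast
  ultimately show "smooth (sqrt ((1 / real n) * (\<Sum>i<n. (Li i)\<^sup>2))) f"
    by (simp add: smooth_def)
qed

subsection \<open>Joint measurability\<close>

text \<open>The point is approximated by simple functions \<open>s i\<close>. For points from a
  finite set measurability in \<open>z\<close> is enough, and continuity in the point carries it to
  the limit.\<close>

lemma borel_measurable_Caratheodory:
  fixes F :: "'z \<Rightarrow> 'a::{metric_space, second_countable_topology} \<Rightarrow> real"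
  assumes meas: "\<And>y. (\<lambda>z. F z y) \<in> borel_measurable D"
    and cont: "\<And>z. z \<in> space D \<Longrightarrow> continuous_on UNIV (F z)"
  shows "(\<lambda>(z, y). F z y) \<in> borel_measurable (D \<Otimes>\<^sub>M borel)"
proof -
  obtain s :: "nat \<Rightarrow> 'a \<Rightarrow> 'a" where s: "\<And>i. simple_function borel (s i)"
    and lim: "\<And>y. (\<lambda>i. s i y) \<longlonglongrightarrow> y"
    using borel_measurable_implies_sequence_metric[of "\<lambda>y. y" borel undefined] by auto
  show ?thesis
  proof (rule borel_measurable_LIMSEQ_real)
    fix i
    have [measurable]: "s i \<in> borel \<rightarrow>\<^sub>M count_space (range (s i))"
      using measurable_simple_function[OF s] by (auto simp: measurable_def)
    note [measurable] = meas
    have "(\<lambda>x. F (fst x) (s i (snd x))) \<in> borel_measurable (D \<Otimes>\<^sub>M borel)"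
      by (rule measurable_compose_countable'[where I = "range (s i)"])
        (use simple_functionD(1)[OF s[of i]] in \<open>auto intro: countable_finite\<close>)
    then show "(\<lambda>(z, y). F z (s i y)) \<in> borel_measurable (D \<Otimes>\<^sub>M borel)"
      by (simp add: case_prod_beta')
  next
    fix x assume "x \<in> space (D \<Otimes>\<^sub>M borel :: ('z \<times> 'a) measure)"
    then have "isCont (F (fst x)) (snd x)"
      using cont by (auto simp: space_pair_measure continuous_on_eq_continuous_at)
    from isCont_tendsto_compose[OF this lim]
    show "(\<lambda>i. case x of (z, y) \<Rightarrow> F z (s i y)) \<longlonglongrightarrow> (case x of (z, y) \<Rightarrow> F z y)"
      by (simp add: case_prod_beta')
  qed
qed

text \<open>\<open>grad\<close> is a definite description, so measurability has to come from a
  formula: its inner product with \<open>v\<close> is the limit of the difference quotients along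
  \<open>v\<close> with steps \<open>1/(m+1)\<close>.\<close>

lemma borel_measurable_grad:
  fixes F :: "'z \<Rightarrow> real ^ 'd::finite \<Rightarrow> real"
  assumes meas: "\<And>y. (\<lambda>z. F z y) \<in> borel_measurable D"
    and diff: "\<And>z y. z \<in> space D \<Longrightarrow> F z differentiable (at y)"
  shows "(\<lambda>(z, y). grad (F z) y) \<in> borel_measurable (D \<Otimes>\<^sub>M borel)"
proof (subst borel_measurable_euclidean_space, intro ballI)
  fix v :: "real ^ 'd"
  have [measurable]: "(\<lambda>(z, y). F z y) \<in> borel_measurable (D \<Otimes>\<^sub>M borel)"
    using meas diff
    by (intro borel_measurable_Caratheodory)
      (auto simp: continuous_on_eq_continuous_at intro: differentiable_imp_continuous_within)
  let ?h = "\<lambda>m. inverse (real (Suc m))"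
  have "(\<lambda>x. grad (F (fst x)) (snd x) \<bullet> v) \<in> borel_measurable (D \<Otimes>\<^sub>M borel)"
  proof (rule borel_measurable_LIMSEQ_real)
    fix x assume "x \<in> space (D \<Otimes>\<^sub>M borel :: ('z \<times> (real ^ 'd)) measure)"
    then have "((\<lambda>t. F (fst x) (snd x + t *\<^sub>R v)) has_real_derivative
        v \<bullet> grad (F (fst x)) (snd x)) (at 0)"
      using DERIV_along_line[of "F (fst x)" "snd x" 0 v] diff[of "fst x"]
      by (auto simp: space_pair_measure)
    then have "((\<lambda>h. (F (fst x) (snd x + h *\<^sub>R v) - F (fst x) (snd x)) / h) \<longlongrightarrow>
        v \<bullet> grad (F (fst x)) (snd x)) (at 0)"
      by (simp add: DERIV_def)
    moreover have "filterlim ?h (at 0) sequentially"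
      by (intro filterlim_atI LIMSEQ_inverse_real_of_nat) auto
    ultimately have "(\<lambda>m. (F (fst x) (snd x + ?h m *\<^sub>R v) - F (fst x) (snd x)) / ?h m)
        \<longlonglongrightarrow> v \<bullet> grad (F (fst x)) (snd x)"
      by (rule filterlim_compose)
    then show "(\<lambda>m. (F (fst x) (snd x + ?h m *\<^sub>R v) - F (fst x) (snd x)) / ?h m)
        \<longlonglongrightarrow> grad (F (fst x)) (snd x) \<bullet> v"
      by (subst inner_commute)
  next
    fix m
    have [measurable]: "(\<lambda>x. F (fst x) (snd x + ?h m *\<^sub>R v)) \<in> borel_measurable (D \<Otimes>\<^sub>M borel)"
      using measurable_compose[of "\<lambda>x. (fst x, snd x + ?h m *\<^sub>R v)" "D \<Otimes>\<^sub>M borel" "D \<Otimes>\<^sub>M borel"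
          "\<lambda>(z, y). F z y" borel] by simp
    have [measurable]: "(\<lambda>x. F (fst x) (snd x)) \<in> borel_measurable (D \<Otimes>\<^sub>M borel)"
      using measurable_compose[of "\<lambda>x. (fst x, snd x)" "D \<Otimes>\<^sub>M borel" "D \<Otimes>\<^sub>M borel"
          "\<lambda>(z, y). F z y" borel] by simp
    show "(\<lambda>x. (F (fst x) (snd x + ?h m *\<^sub>R v) - F (fst x) (snd x)) / ?h m)
        \<in> borel_measurable (D \<Otimes>\<^sub>M borel)" by measurable
  qed
  then show "(\<lambda>x. (case x of (z, y) \<Rightarrow> grad (F z) y) \<bullet> v) \<in> borel_measurable (D \<Otimes>\<^sub>M borel)"
    by (simp add: case_prod_beta')
qed

lemma borel_measurable_nnz:
  "(\<lambda>y :: real ^ 'd::finite. real (nnz y)) \<in> borel_measurable borel"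
proof -
  have "real (nnz y) = (\<Sum>j\<in>UNIV. if y $ j \<noteq> 0 then 1 else 0)" for y :: "real ^ 'd"
    by (simp add: nnz_def sum.If_cases)
  moreover have [measurable]: "(\<lambda>y :: real ^ 'd. y $ j) \<in> borel_measurable borel" for j
    by (intro borel_measurable_continuous_onI continuous_intros)
  ultimately show ?thesis by simp
qed

lemma nnz_le: "nnz (y :: real ^ 'd::finite) \<le> CARD('d)"
  unfolding nnz_def by (intro card_mono) auto

subsection \<open>Square-integrable random vectors\<close>

definition square_integrable :: "'m measure \<Rightarrow> ('m \<Rightarrow> 'a::euclidean_space) \<Rightarrow> bool" where
  "square_integrable M X \<longleftrightarrow> X \<in> borel_measurable M \<and> integrable M (\<lambda>w. (norm (X w))\<^sup>2)"

lemma square_integrableD: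
  assumes "square_integrable M X"
  shows "X \<in> borel_measurable M" "integrable M (\<lambda>w. (norm (X w))\<^sup>2)"
  using assms by (auto simp: square_integrable_def)

lemma square_integrable_dominated:
  assumes "X \<in> borel_measurable M" "integrable M h"
    and "\<And>w. w \<in> space M \<Longrightarrow> (norm (X w))\<^sup>2 \<le> h w"
  shows "square_integrable M X"
  unfolding square_integrable_def
proof
  show "integrable M (\<lambda>w. (norm (X w))\<^sup>2)"
    using assms(1,3) by (intro Bochner_Integration.integrable_bound[OF assms(2)] AE_I2)
      (auto intro: order_trans[OF _ abs_ge_self])
qed fact

lemma norm_add_sq_le: "(norm (a + b))\<^sup>2 \<le> 2 * (norm a)\<^sup>2 + 2 * (norm (b :: 'a::real_inner))\<^sup>2"
proof -
  have "0 \<le> (norm (a - b))\<^sup>2" by simp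
  then show ?thesis
    by (simp add: power2_norm_eq_inner inner_add_left inner_add_right inner_diff_left
        inner_diff_right inner_commute)
qed

lemma square_integrable_add:
  assumes X: "square_integrable M X" and Y: "square_integrable M Y"
  shows "square_integrable M (\<lambda>w. X w + Y w)"
  using square_integrableD[OF X] square_integrableD[OF Y]
  by (intro square_integrable_dominated[where h = "\<lambda>w. 2 * (norm (X w))\<^sup>2 + 2 * (norm (Y w))\<^sup>2"])
    (auto intro: norm_add_sq_le)

lemma square_integrable_scaleR:
  "square_integrable M X \<Longrightarrow> square_integrable M (\<lambda>w. a *\<^sub>R X w)"
  by (auto simp: square_integrable_def power_mult_distrib)

lemma square_integrable_diff:
  assumes X: "square_integrable M X" and Y: "square_integrable M Y"
  shows "square_integrable M (\<lambda>w. X w - Y w)"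
  using square_integrable_add[OF X square_integrable_scaleR[OF Y, of "-1"]] by simp

lemma square_integrable_sum:
  assumes "\<And>i. i \<in> I \<Longrightarrow> square_integrable M (X i)"
  shows "square_integrable M (\<lambda>w. \<Sum>i\<in>I. X i w)"
  using assms
  by (induction I rule: infinite_finite_induct)
    (auto simp: square_integrable_add, simp_all add: square_integrable_def)

lemma square_integrable_If:
  assumes X: "square_integrable M X" and Y: "square_integrable M Y"
    and P: "Measurable.pred M P"
  shows "square_integrable M (\<lambda>w. if P w then X w else Y w)"
  using square_integrableD[OF X] square_integrableD[OF Y] P
  by (intro square_integrable_dominated[where h = "\<lambda>w. (norm (X w))\<^sup>2 + (norm (Y w))\<^sup>2"]) auto

lemma (in finite_measure) square_integrable_const: "square_integrable M (\<lambda>_. a)"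
  by (auto simp: square_integrable_def)

lemma (in finite_measure) square_integrable_Lipschitz:
  fixes h :: "'b::euclidean_space \<Rightarrow> 'c::euclidean_space"
  assumes X: "square_integrable M X" and lip: "\<And>x y. norm (h x - h y) \<le> C * norm (x - y)"
  shows "square_integrable M (\<lambda>w. h (X w))"
proof -
  have "continuous_on UNIV h"
  proof (rule continuous_on_subset[OF lipschitz_on_continuous_on])
    show "\<bar>C\<bar>-lipschitz_on UNIV h"
      by (intro lipschitz_onI) (auto simp: dist_norm intro!: order_trans[OF lip] mult_right_mono)
  qed simp
  then have [measurable]: "h \<in> borel_measurable borel" by (rule borel_measurable_continuous_onI)
  note [measurable] = square_integrableD(1)[OF X]
  have "square_integrable M (\<lambda>w. h (X w) - h 0)"
  proof (rule square_integrable_dominated)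
    show "integrable M (\<lambda>w. C\<^sup>2 * (norm (X w))\<^sup>2)" using square_integrableD(2)[OF X] by simp
    fix w
    have "(norm (h (X w) - h 0))\<^sup>2 \<le> (C * norm (X w))\<^sup>2"
      using lip[of "X w" 0] by (intro power_mono) auto
    then show "(norm (h (X w) - h 0))\<^sup>2 \<le> C\<^sup>2 * (norm (X w))\<^sup>2" by (simp add: power_mult_distrib)
  qed measurable
  from square_integrable_add[OF this square_integrable_const[of "h 0"]] show ?thesis by simp
qed

lemma integrable_inner_square_integrable:
  assumes X: "square_integrable M X" and Y: "square_integrable M Y"
  shows "integrable M (\<lambda>w. X w \<bullet> Y w)"
proof (rule Bochner_Integration.integrable_bound)
  show "integrable M (\<lambda>w. (norm (X w))\<^sup>2 + (norm (Y w))\<^sup>2)"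
    using square_integrableD[OF X] square_integrableD[OF Y] by simp
  show "AE w in M. norm (X w \<bullet> Y w) \<le> norm ((norm (X w))\<^sup>2 + (norm (Y w))\<^sup>2)"
  proof (rule AE_I2)
    fix w
    have "\<bar>X w \<bullet> Y w\<bar> \<le> norm (X w) * norm (Y w)" by (rule Cauchy_Schwarz_ineq2)
    also have "2 * (norm (X w) * norm (Y w)) \<le> (norm (X w))\<^sup>2 + (norm (Y w))\<^sup>2"
      using sum_squares_bound[of "norm (X w)" "norm (Y w)"] by simp
    finally show "norm (X w \<bullet> Y w) \<le> norm ((norm (X w))\<^sup>2 + (norm (Y w))\<^sup>2)" by simp
  qed
  show "(\<lambda>w. X w \<bullet> Y w) \<in> borel_measurable M"
    using square_integrableD(1)[OF X] square_integrableD(1)[OF Y] by measurable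
qed

definition second_moment :: "'m measure \<Rightarrow> ('m \<Rightarrow> 'a::euclidean_space) \<Rightarrow> real" where
  "second_moment M X = (\<integral>w. (norm (X w))\<^sup>2 \<partial>M)"

lemma second_moment_nonneg: "0 \<le> second_moment M X"
  by (simp add: second_moment_def)

lemma second_moment_scaleR: "second_moment M (\<lambda>w. a *\<^sub>R X w) = a\<^sup>2 * second_moment M X"
  by (simp add: second_moment_def power_mult_distrib)

lemma second_moment_mono:
  assumes "square_integrable M X" "square_integrable M Y"
    and "\<And>w. norm (X w) \<le> c * norm (Y w)"
  shows "second_moment M X \<le> c\<^sup>2 * second_moment M Y"
proof -
  have "(norm (X w))\<^sup>2 \<le> c\<^sup>2 * (norm (Y w))\<^sup>2" for w
    using power_mono[OF assms(3)[of w], of 2] by (simp add: power_mult_distrib)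
  then have "second_moment M X \<le> (\<integral>w. c\<^sup>2 * (norm (Y w))\<^sup>2 \<partial>M)"
    unfolding second_moment_def
    using assms by (intro integral_mono) (auto simp: square_integrable_def)
  then show ?thesis by (simp add: second_moment_def)
qed

lemma second_moment_add_orthogonal:
  assumes X: "square_integrable M X" and Y: "square_integrable M Y"
    and orth: "(\<integral>w. X w \<bullet> Y w \<partial>M) = 0"
  shows "second_moment M (\<lambda>w. X w + Y w) = second_moment M X + second_moment M Y"
proof -
  have "(norm (X w + Y w))\<^sup>2 = (norm (X w))\<^sup>2 + (norm (Y w))\<^sup>2 + 2 * (X w \<bullet> Y w)" for w
    by (simp add: power2_norm_eq_inner inner_add_left inner_add_right inner_commute)
  then show ?thesis
    using square_integrableD[OF X] square_integrableD[OF Y] integrable_inner_square_integrable[OF X Y]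
    by (simp add: second_moment_def orth)
qed

lemma orthogonal_sum_left:
  assumes "\<And>i. i \<in> I \<Longrightarrow> square_integrable M (X i)" "square_integrable M Y"
    and "\<And>i. i \<in> I \<Longrightarrow> (\<integral>w. X i w \<bullet> Y w \<partial>M) = 0"
  shows "(\<integral>w. (\<Sum>i\<in>I. X i w) \<bullet> Y w \<partial>M) = 0"
  using assms
  by (simp add: inner_sum_left Bochner_Integration.integral_sum integrable_inner_square_integrable)

lemma orthogonal_add_left:
  assumes "square_integrable M X" "square_integrable M Y" "square_integrable M Z"
    and "(\<integral>w. X w \<bullet> Z w \<partial>M) = 0" "(\<integral>w. Y w \<bullet> Z w \<partial>M) = 0"
  shows "(\<integral>w. (X w + Y w) \<bullet> Z w \<partial>M) = 0"
  using assms by (simp add: inner_add_left integrable_inner_square_integrable)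

lemma second_moment_sum_orthogonal:
  assumes "finite I" and X: "\<And>i. i \<in> I \<Longrightarrow> square_integrable M (X i)"
    and orth: "\<And>i j. i \<in> I \<Longrightarrow> j \<in> I \<Longrightarrow> i \<noteq> j \<Longrightarrow> (\<integral>w. X i w \<bullet> X j w \<partial>M) = 0"
  shows "second_moment M (\<lambda>w. \<Sum>i\<in>I. X i w) = (\<Sum>i\<in>I. second_moment M (X i))"
  using assms
proof (induction I rule: finite_induct)
  case (insert i I)
  have "(\<integral>w. (\<Sum>j\<in>I. X j w) \<bullet> X i w \<partial>M) = 0"
    using insert by (intro orthogonal_sum_left) auto
  then have "second_moment M (\<lambda>w. X i w + (\<Sum>j\<in>I. X j w)) =
      second_moment M (X i) + second_moment M (\<lambda>w. \<Sum>j\<in>I. X j w)"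
    using insert.prems
    by (intro second_moment_add_orthogonal square_integrable_sum) (auto simp: inner_commute)
  with insert show ?case by simp
qed (simp add: second_moment_def)

text \<open>A finite bound in \<open>ennreal\<close> yields integrability and the real bound
  together, so frozen integrals can be estimated before anything is known to be integrable.\<close>

lemma square_integrable_nn_bound:
  assumes X: "X \<in> borel_measurable M" and "0 \<le> c"
    and "(\<integral>\<^sup>+w. ennreal ((norm (X w))\<^sup>2) \<partial>M) \<le> ennreal c"
  shows "square_integrable M X" "second_moment M X \<le> c"
proof -
  have int: "integrable M (\<lambda>w. (norm (X w))\<^sup>2)"
    by (rule integrableI_nonneg) (use assms in \<open>auto intro: le_less_trans\<close>)
  with X show "square_integrable M X" by (simp add: square_integrable_def)
  have "ennreal (second_moment M X) \<le> ennreal c"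
    unfolding second_moment_def using assms(3) by (simp add: nn_integral_eq_integral[OF int, symmetric])
  with \<open>0 \<le> c\<close> show "second_moment M X \<le> c" by simp
qed

subsection \<open>Integrating out an independent random variable\<close>

context prob_space
begin

text \<open>Grouping of independent families: the blocks \<open>A\<close> and \<open>{s}\<close> of
  the index set are numbered by \<open>bool\<close>, and each block may be replaced by the
  sigma-algebra it generates.\<close>

lemma indep_set_generated:
  assumes indep: "indep_sets E I" and A: "A \<subseteq> I" "s \<in> I" "s \<notin> A"
    and sa: "\<And>t. t \<in> I \<Longrightarrow> sigma_algebra (space M) (E t)"
  shows "indep_set (sigma_sets (space M) (\<Union>t\<in>A. E t)) (E s)"
proof -
  have "indep_sets (\<lambda>j. sigma_sets (space M) (\<Union>t\<in>case_bool A {s} j. E t)) UNIV"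
  proof (rule indep_sets_collect_sigma)
    show "indep_sets E (\<Union>j\<in>UNIV. case_bool A {s} j)"
      by (rule indep_sets_mono_index[OF _ indep]) (use A in \<open>auto split: bool.splits\<close>)
    show "Int_stable (E t)" if "t \<in> case_bool A {s} j" for j t
    proof -
      have "t \<in> I" using that A by (auto split: bool.splits)
      then interpret sigma_algebra "space M" "E t" by (rule sa)
      show ?thesis by (auto simp: Int_stable_def)
    qed
    show "disjoint_family_on (case_bool A {s}) UNIV"
      using A by (auto simp: disjoint_family_on_def split: bool.splits)
  qed
  then show ?thesis
    unfolding indep_set_def
    by (rule indep_sets_mono_sets) (auto split: bool.splits)
qed

context
  fixes G :: "'a measure" and T :: "'t measure" and V :: "'a \<Rightarrow> 't"
  assumes sub: "subalgebra M G" and V: "V \<in> M \<rightarrow>\<^sub>M T"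
    and indep: "indep_set (sets G) (sets (vimage_algebra (space M) V T))"
begin

text \<open>The identity, viewed as a random element of \<open>G\<close>, carries all the
  information in \<open>G\<close>, so independence makes its joint law with \<open>V\<close> a
  product measure. Fubini on this product plays the part of conditioning on
  \<open>G\<close>.\<close>

lemma distr_pair_indep:
  "distr M G (\<lambda>w. w) \<Otimes>\<^sub>M distr M T V = distr M (G \<Otimes>\<^sub>M T) (\<lambda>w. (w, V w))"
proof (rule pair_measure_eqI)
  have id[measurable]: "(\<lambda>w. w) \<in> M \<rightarrow>\<^sub>M G"
    using sub measurable_from_subalg[OF sub measurable_ident_sets[OF refl]] by simp
  note [measurable] = V
  show "sigma_finite_measure (distr M G (\<lambda>w. w))" "sigma_finite_measure (distr M T V)"
    using prob_space_distr[OF id] prob_space_distr[OF V] by (simp_all add: prob_space_imp_sigma_finite)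
  show "sets (distr M G (\<lambda>w. w) \<Otimes>\<^sub>M distr M T V) = sets (distr M (G \<Otimes>\<^sub>M T) (\<lambda>w. (w, V w)))"
    by simp
  fix A B assume "A \<in> sets (distr M G (\<lambda>w. w))" "B \<in> sets (distr M T V)"
  then have A[measurable]: "A \<in> sets G" and B[measurable]: "B \<in> sets T" by simp_all
  have AM: "A \<in> events" "A \<subseteq> space M"
    using A sub sets.sets_into_space[OF A] by (auto simp: subalgebra_def)
  have "V -` B \<inter> space M \<in> sets (vimage_algebra (space M) V T)"
    using B by (rule in_vimage_algebra)
  then have "prob (A \<inter> (V -` B \<inter> space M)) = prob A * prob (V -` B \<inter> space M)"
    by (rule indep_setD[OF indep A])
  moreover have "(\<lambda>w. (w, V w)) -` (A \<times> B) \<inter> space M = A \<inter> (V -` B \<inter> space M)" by auto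
  moreover have "(\<lambda>w. w) -` A \<inter> space M = A" using AM by auto
  ultimately show "emeasure (distr M G (\<lambda>w. w)) A * emeasure (distr M T V) B =
      emeasure (distr M (G \<Otimes>\<^sub>M T) (\<lambda>w. (w, V w))) (A \<times> B)"
    by (simp add: emeasure_distr emeasure_eq_measure ennreal_mult'')
qed

text \<open>Tonelli's version, free of integrability; the bounds that establish square integrability
  are read off from its right side.\<close>

lemma nn_integral_freeze:
  assumes [measurable]: "(\<lambda>(w, s). \<phi> w s) \<in> borel_measurable (G \<Otimes>\<^sub>M T)"
  shows "(\<integral>\<^sup>+w. \<phi> w (V w) \<partial>M) = (\<integral>\<^sup>+w. \<integral>\<^sup>+s. \<phi> w s \<partial>distr M T V \<partial>M)"
proof -
  have id[measurable]: "(\<lambda>w. w) \<in> M \<rightarrow>\<^sub>M G"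
    using sub measurable_from_subalg[OF sub measurable_ident_sets[OF refl]] by simp
  note [measurable] = V
  interpret T: prob_space "distr M T V" by (rule prob_space_distr[OF V])
  have "(\<integral>\<^sup>+w. \<phi> w (V w) \<partial>M) = (\<integral>\<^sup>+x. (case x of (w, s) \<Rightarrow> \<phi> w s) \<partial>distr M (G \<Otimes>\<^sub>M T) (\<lambda>w. (w, V w)))"
    by (subst nn_integral_distr) simp_all
  also have "\<dots> = (\<integral>\<^sup>+w. \<integral>\<^sup>+s. \<phi> w s \<partial>distr M T V \<partial>distr M G (\<lambda>w. w))"
    unfolding distr_pair_indep[symmetric] by (subst T.nn_integral_fst[symmetric]) simp_all
  also have "\<dots> = (\<integral>\<^sup>+w. \<integral>\<^sup>+s. \<phi> w s \<partial>distr M T V \<partial>M)"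
    by (subst nn_integral_distr) simp_all
  finally show ?thesis .
qed

lemma integral_freeze:
  fixes \<phi> :: "'a \<Rightarrow> 't \<Rightarrow> real"
  assumes [measurable]: "(\<lambda>(w, s). \<phi> w s) \<in> borel_measurable (G \<Otimes>\<^sub>M T)"
    and int: "integrable M (\<lambda>w. \<phi> w (V w))"
  shows "(\<integral>w. \<phi> w (V w) \<partial>M) = (\<integral>w. (\<integral>s. \<phi> w s \<partial>distr M T V) \<partial>M)"
proof -
  have id[measurable]: "(\<lambda>w. w) \<in> M \<rightarrow>\<^sub>M G"
    using sub measurable_from_subalg[OF sub measurable_ident_sets[OF refl]] by simp
  note [measurable] = V
  interpret T: prob_space "distr M T V" by (rule prob_space_distr[OF V])
  interpret G: prob_space "distr M G (\<lambda>w. w)" by (rule prob_space_distr[OF id])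
  interpret GT: pair_prob_space "distr M G (\<lambda>w. w)" "distr M T V" ..
  have int': "integrable (distr M G (\<lambda>w. w) \<Otimes>\<^sub>M distr M T V) (\<lambda>(w, s). \<phi> w s)"
    unfolding distr_pair_indep
    using int integrable_distr_eq[of "\<lambda>w. (w, V w)" M "G \<Otimes>\<^sub>M T" "\<lambda>(w, s). \<phi> w s"]
    by simp
  have "(\<integral>w. \<phi> w (V w) \<partial>M) = (\<integral>x. (case x of (w, s) \<Rightarrow> \<phi> w s) \<partial>distr M (G \<Otimes>\<^sub>M T) (\<lambda>w. (w, V w)))"
    by (subst integral_distr) simp_all
  also have "\<dots> = (\<integral>w. \<integral>s. \<phi> w s \<partial>distr M T V \<partial>distr M G (\<lambda>w. w))"
    unfolding distr_pair_indep[symmetric] using GT.integral_fst[OF int'] by simp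
  also have "\<dots> = (\<integral>w. \<integral>s. \<phi> w s \<partial>distr M T V \<partial>M)"
    by (subst integral_distr) simp_all
  finally show ?thesis .
qed

text \<open>With \<open>w\<close> frozen, \<open>\<psi> w\<close> is a constant vector and leaves
  the inner integral, which becomes the inner product of the zero mean with it. Square integrability
  of both factors is what licenses Fubini.\<close>

lemma orthogonal_freeze:
  fixes \<phi> :: "'a \<Rightarrow> 't \<Rightarrow> 'e::euclidean_space"
  assumes [measurable]: "(\<lambda>(w, s). \<phi> w s) \<in> borel_measurable (G \<Otimes>\<^sub>M T)"
      "\<psi> \<in> borel_measurable G"
    and mean: "\<And>w. w \<in> space M \<Longrightarrow> has_bochner_integral (distr M T V) (\<phi> w) 0"
    and "square_integrable M (\<lambda>w. \<phi> w (V w))" "square_integrable M \<psi>"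
  shows "(\<integral>w. \<phi> w (V w) \<bullet> \<psi> w \<partial>M) = 0"
proof -
  have "(\<integral>w. \<phi> w (V w) \<bullet> \<psi> w \<partial>M) = (\<integral>w. (\<integral>s. \<phi> w s \<bullet> \<psi> w \<partial>distr M T V) \<partial>M)"
    using assms by (intro integral_freeze integrable_inner_square_integrable) measurable
  also have "\<dots> = (\<integral>w. 0 \<partial>M)"
    using mean has_bochner_integral_inner_left[of _ "distr M T V"]
    by (intro Bochner_Integration.integral_cong)
      (auto dest!: has_bochner_integral_integral_eq simp: has_bochner_integral_iff)
  finally show ?thesis by simp
qed

end

end

lemma sigma_algebra_vimage_algebra: "sigma_algebra X (sets (vimage_algebra X V T))"
  using sets.sigma_algebra_axioms[of "vimage_algebra X V T"] by simp

lemma nn_integral_expectation_le: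
  assumes "expectation_le M X c" "\<And>w. 0 \<le> X w"
  shows "(\<integral>\<^sup>+w. ennreal (X w) \<partial>M) \<le> ennreal c"
  using assms by (simp add: expectation_le_def nn_integral_eq_integral ennreal_leI)

lemma smooth_borel_measurable_grad:
  assumes "smooth L f"
  shows "grad f \<in> borel_measurable borel"
proof (rule borel_measurable_continuous_onI, rule lipschitz_on_continuous_on)
  show "\<bar>L\<bar>-lipschitz_on UNIV (grad f)"
    using assms unfolding smooth_def lipschitz_on_def dist_norm
    by (auto intro: order_trans[OF _ mult_right_mono[OF abs_ge_self norm_ge_zero]])
qed

subsection \<open>Quantization operators\<close>

lemma integrable_nnz:
  assumes "prob_space P" "X \<in> borel_measurable P"
  shows "integrable P (\<lambda>w. real (nnz (X w :: real ^ 'e::finite)))"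
proof -
  interpret P: prob_space P by fact
  show ?thesis
    using measurable_compose[OF assms(2) borel_measurable_nnz] nnz_le
    by (intro P.integrable_const_bound[where B = "real CARD('e)"]) auto
qed

locale quantizer =
  fixes N :: "'q measure" and \<Q> :: "'q \<Rightarrow> real ^ 'd::finite \<Rightarrow> real ^ 'd" and \<omega> :: real
  assumes quantization: "quantization_operator N \<Q> \<omega>"
begin

lemma
  shows quantizer_prob_space: "prob_space N"
    and quantizer_measurable: "(\<lambda>(s, y). \<Q> s y) \<in> borel_measurable (N \<Otimes>\<^sub>M borel)"
    and omega_pos: "\<omega> > 0"
    and quantizer_unbiased: "has_bochner_integral N (\<lambda>s. \<Q> s y) y"
    and quantizer_variance: "expectation_le N (\<lambda>s. (norm (\<Q> s y - y))\<^sup>2) (\<omega> * (norm y)\<^sup>2)"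
  using quantization unfolding quantization_operator_def by blast+

lemma quantizer_measurable_compose:
  assumes "S \<in> G \<rightarrow>\<^sub>M N" "Y \<in> borel_measurable G"
  shows "(\<lambda>w. \<Q> (S w) (Y w)) \<in> borel_measurable G"
  using measurable_compose[OF measurable_Pair[OF assms] quantizer_measurable] by simp

lemma quantization_error_mean: "has_bochner_integral N (\<lambda>s. \<Q> s y - y) 0"
proof -
  interpret N: prob_space N by (rule quantizer_prob_space)
  have "has_bochner_integral N (\<lambda>s. y) y"
    by (simp add: has_bochner_integral_iff N.prob_space)
  from has_bochner_integral_diff[OF quantizer_unbiased[of y] this] show ?thesis by simp
qed

lemma quantizer_section_measurable: "(\<lambda>s. \<Q> s y) \<in> borel_measurable N"
  using quantizer_unbiased[of y] by (simp add: has_bochner_integral_iff borel_measurable_integrable)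

lemma expected_nnz_le: "(\<integral>s. real (nnz (\<Q> s y)) \<partial>N) \<le> real CARD('d)"
proof -
  interpret N: prob_space N by (rule quantizer_prob_space)
  have "(\<integral>s. real (nnz (\<Q> s y)) \<partial>N) \<le> (\<integral>s. real CARD('d) \<partial>N)"
    using nnz_le by (intro integral_mono integrable_nnz quantizer_section_measurable
        quantizer_prob_space) auto
  then show ?thesis by (simp add: N.prob_space)
qed

text \<open>A real supremum is only informative for a set bounded above; the dimension is the
  bound.\<close>

lemma expected_nnz_le_density: "(\<integral>s. real (nnz (\<Q> s y)) \<partial>N) \<le> expected_density N \<Q>"
  unfolding expected_density_def
  by (rule cSUP_upper) (use expected_nnz_le in \<open>auto intro!: bdd_aboveI\<close>)

lemma expected_density_le: "expected_density N \<Q> \<le> real CARD('d)"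
  unfolding expected_density_def by (rule cSUP_least) (use expected_nnz_le in auto)

text \<open>An operator that sends a nonzero vector to 0 almost surely would be biased; the all-ones
  vector serves as that vector. Divisions by the density and by \<open>p\<close> rest on
  this.\<close>

lemma expected_density_pos: "0 < expected_density N \<Q>"
proof -
  let ?y = "(\<chi> j. 1) :: real ^ 'd"
  have "(\<integral>s. real (nnz (\<Q> s ?y)) \<partial>N) \<noteq> 0"
  proof
    assume "(\<integral>s. real (nnz (\<Q> s ?y)) \<partial>N) = 0"
    then have "AE s in N. real (nnz (\<Q> s ?y)) = 0"
      by (subst (asm) integral_nonneg_eq_0_iff_AE)
        (auto intro: integrable_nnz quantizer_section_measurable quantizer_prob_space)
    then have "AE s in N. \<Q> s ?y = 0"
      by eventually_elim (auto simp: nnz_def vec_eq_iff)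
    then have "(\<integral>s. \<Q> s ?y \<partial>N) = (\<integral>s. 0 \<partial>N)"
      by (intro integral_cong_AE) (auto intro: quantizer_section_measurable)
    then have "?y = 0" using quantizer_unbiased[of ?y] by (simp add: has_bochner_integral_iff)
    then show False by (simp add: vec_eq_iff)
  qed
  moreover have "0 \<le> (\<integral>s. real (nnz (\<Q> s ?y)) \<partial>N)" by simp
  ultimately show ?thesis using expected_nnz_le_density[of ?y] by linarith
qed

end

subsection \<open>The run of the method\<close>

text \<open>\<open>\<gamma>\<close> is arbitrary here and \<open>p\<close> any number in [0, 1]: the
  particular choices of both, and of \<open>b\<close>, enter only once the inequalities for the run
  have been summed.\<close>

locale vr_marina_run = prob_space M + quantizer N \<Q> \<omega>
  for M :: "'m measure" and N :: "'q measure"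
    and \<Q> :: "'q \<Rightarrow> real ^ 'd::finite \<Rightarrow> real ^ 'd" and \<omega> :: real +
  fixes \<D> :: "nat \<Rightarrow> 'z measure"
    and n b b' :: nat
    and F :: "nat \<Rightarrow> 'z \<Rightarrow> real ^ 'd \<Rightarrow> real"
    and fi :: "nat \<Rightarrow> real ^ 'd \<Rightarrow> real"
    and Li \<L>i \<sigma>i :: "nat \<Rightarrow> real"
    and p \<gamma> :: real
    and x0 :: "real ^ 'd"
    and \<xi> :: "nat \<Rightarrow> nat \<Rightarrow> nat \<Rightarrow> 'm \<Rightarrow> 'z" and c :: "nat \<Rightarrow> 'm \<Rightarrow> bool"
    and q :: "nat \<Rightarrow> nat \<Rightarrow> 'm \<Rightarrow> 'q"
    and x g :: "nat \<Rightarrow> 'm \<Rightarrow> real ^ 'd" and gw \<Delta> :: "nat \<Rightarrow> nat \<Rightarrow> 'm \<Rightarrow> real ^ 'd"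
  assumes sizes: "n \<ge> 1" "1 \<le> b'" "b' \<le> b"
    and data: "\<And>i. i < n \<Longrightarrow> prob_space (\<D> i)"
    and differentiable: "\<And>i z y. i < n \<Longrightarrow> z \<in> space (\<D> i) \<Longrightarrow> F i z differentiable (at y)"
    and F_measurable: "\<And>i y. i < n \<Longrightarrow> (\<lambda>z. F i z y) \<in> borel_measurable (\<D> i)"
    and smooth: "\<And>i. i < n \<Longrightarrow> smooth (Li i) (fi i)"
    and unbiased: "\<And>i y. i < n \<Longrightarrow>
          has_bochner_integral (\<D> i) (\<lambda>z. grad (F i z) y) (grad (fi i) y)"
    and variance: "\<And>i y. i < n \<Longrightarrow>
          expectation_le (\<D> i) (\<lambda>z. (norm (grad (F i z) y - grad (fi i) y))\<^sup>2) ((\<sigma>i i)\<^sup>2)"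
    and p: "0 \<le> p" "p \<le> 1"
    and sources: "independent_sources M n b \<D> N p \<xi> c q"
    and algorithm: "vr_marina_online n b b' \<gamma> x0 F \<Q> \<xi> c q x g gw \<Delta>"
    and average_smooth: "average_smooth M n b' fi x \<Delta> \<L>i"
begin

section \<open>Sigma-algebras generated by sets of sources\<close>

definition src :: "source set" where
  "src = {Sample k i j | k i j. i < n \<and> j < b} \<union> range Coin \<union> {Seed k i | k i. i < n}"

definition source_events :: "source \<Rightarrow> 'm set set" where
  "source_events s = (case s of
     Sample k i j \<Rightarrow> sets (vimage_algebra (space M) (\<xi> k i j) (\<D> i))
   | Coin k \<Rightarrow> sets (vimage_algebra (space M) (c k) (count_space UNIV))
   | Seed k i \<Rightarrow> sets (vimage_algebra (space M) (q k i) N))"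

text \<open>What is known when exactly the sources in \<open>A\<close> are revealed. Indexing by
  arbitrary sets, rather than by time, allows one source to be singled out against all the
  others.\<close>

definition gen :: "source set \<Rightarrow> 'm measure" where
  "gen A = sigma (space M) (\<Union>s\<in>A. source_events s)"

lemma src_simps [simp]:
  "Sample k i j \<in> src \<longleftrightarrow> i < n \<and> j < b" "Coin k \<in> src" "Seed k i \<in> src \<longleftrightarrow> i < n"
  by (auto simp: src_def)

lemma sigma_algebra_source_events: "sigma_algebra (space M) (source_events s)"
  unfolding source_events_def by (cases s) (simp_all add: sigma_algebra_vimage_algebra)

lemma source_events_Pow: "(\<Union>s\<in>A. source_events s) \<subseteq> Pow (space M)"
  using sigma_algebra_source_events unfolding sigma_algebra_iff2 by blast

lemma space_gen [simp]: "space (gen A) = space M"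
  unfolding gen_def by (rule space_measure_of) (rule source_events_Pow)

lemma sets_gen: "sets (gen A) = sigma_sets (space M) (\<Union>s\<in>A. source_events s)"
  unfolding gen_def by (rule sets_measure_of) (rule source_events_Pow)

lemma indep_source_events: "indep_sets source_events src"
  using sources unfolding independent_sources_def src_def source_events_def by blast

lemma subalgebra_gen: "A \<subseteq> src \<Longrightarrow> subalgebra M (gen A)"
  using indep_source_events
  unfolding subalgebra_def sets_gen indep_sets_def
  by (auto intro!: sets.sigma_sets_subset simp del: UN_subset_iff)

lemma measurable_gen_mono: "f \<in> gen A \<rightarrow>\<^sub>M T \<Longrightarrow> A \<subseteq> B \<Longrightarrow> f \<in> gen B \<rightarrow>\<^sub>M T"
  using measurable_mono[of T T "gen A" "gen B"]
  by (auto simp: sets_gen intro!: sigma_sets_mono')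

lemma measurable_gen: "f \<in> gen A \<rightarrow>\<^sub>M T \<Longrightarrow> A \<subseteq> src \<Longrightarrow> f \<in> M \<rightarrow>\<^sub>M T"
  using measurable_from_subalg subalgebra_gen by blast

lemma indep_gen:
  "A \<subseteq> src \<Longrightarrow> s \<in> src \<Longrightarrow> s \<notin> A \<Longrightarrow> indep_set (sets (gen A)) (source_events s)"
  unfolding sets_gen
  by (rule indep_set_generated[OF indep_source_events]) (auto intro: sigma_algebra_source_events)

lemma vimage_measurable_gen:
  assumes "sets (vimage_algebra (space M) V T) \<subseteq> source_events s" "s \<in> A" "V \<in> M \<rightarrow>\<^sub>M T"
  shows "V \<in> gen A \<rightarrow>\<^sub>M T"
proof (rule measurableI)
  fix B assume "B \<in> sets T"
  then have "V -` B \<inter> space M \<in> source_events s"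
    using assms(1) in_vimage_algebra by blast
  then show "V -` B \<inter> space (gen A) \<in> sets (gen A)"
    unfolding sets_gen using assms(2) by auto
qed (use measurable_space[OF assms(3)] in simp)

lemma sample_law:
  assumes "i < n" "j < b"
  shows "\<xi> k i j \<in> M \<rightarrow>\<^sub>M \<D> i" "distr M (\<D> i) (\<xi> k i j) = \<D> i"
  using sources assms unfolding independent_sources_def by blast+

lemma coin_law:
  "c k \<in> M \<rightarrow>\<^sub>M count_space UNIV"
  "distr M (count_space UNIV) (c k) = measure_pmf (bernoulli_pmf p)"
  using sources unfolding independent_sources_def by blast+

lemma seed_law:
  assumes "i < n"
  shows "q k i \<in> M \<rightarrow>\<^sub>M N" "distr M N (q k i) = N"
  using sources assms unfolding independent_sources_def by blast+

lemma sample_measurable_gen: "i < n \<Longrightarrow> j < b \<Longrightarrow> Sample k i j \<in> A \<Longrightarrow> \<xi> k i j \<in> gen A \<rightarrow>\<^sub>M \<D> i"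
  by (rule vimage_measurable_gen) (auto simp: source_events_def sample_law)

lemma coin_measurable_gen: "Coin k \<in> A \<Longrightarrow> c k \<in> gen A \<rightarrow>\<^sub>M count_space UNIV"
  by (rule vimage_measurable_gen) (auto simp: source_events_def coin_law)

lemma seed_measurable_gen: "i < n \<Longrightarrow> Seed k i \<in> A \<Longrightarrow> q k i \<in> gen A \<rightarrow>\<^sub>M N"
  by (rule vimage_measurable_gen) (auto simp: source_events_def seed_law)

section \<open>Centred contributions of a single sample, seed or coin\<close>

definition noise :: "nat \<Rightarrow> 'z \<Rightarrow> real ^ 'd \<Rightarrow> real ^ 'd" where
  "noise i z y = grad (F i z) y - grad (fi i) y"

lemma grad_fi_measurable: "i < n \<Longrightarrow> grad (fi i) \<in> borel_measurable borel"
  using smooth smooth_borel_measurable_grad by blast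

lemma grad_F_measurable:
  "i < n \<Longrightarrow> (\<lambda>(z, y). grad (F i z) y) \<in> borel_measurable (\<D> i \<Otimes>\<^sub>M borel)"
  using F_measurable differentiable by (intro borel_measurable_grad)

lemma grad_F_measurable_compose:
  assumes "i < n" "Z \<in> G \<rightarrow>\<^sub>M \<D> i" "Y \<in> borel_measurable G"
  shows "(\<lambda>w. grad (F i (Z w)) (Y w)) \<in> borel_measurable G"
  using measurable_compose[OF measurable_Pair[OF assms(2,3)] grad_F_measurable[OF assms(1)]] by simp

lemma noise_measurable_compose:
  assumes "i < n" "Z \<in> G \<rightarrow>\<^sub>M \<D> i" "Y \<in> borel_measurable G"
  shows "(\<lambda>w. noise i (Z w) (Y w)) \<in> borel_measurable G"
  unfolding noise_def
  by (intro borel_measurable_diff grad_F_measurable_compose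
      measurable_compose[OF assms(3) grad_fi_measurable] assms)

lemma noise_mean: "i < n \<Longrightarrow> has_bochner_integral (\<D> i) (\<lambda>z. noise i z y) 0"
proof -
  assume i: "i < n"
  interpret D: prob_space "\<D> i" by (rule data[OF i])
  have "has_bochner_integral (\<D> i) (\<lambda>z. grad (fi i) y) (grad (fi i) y)"
    by (simp add: has_bochner_integral_iff D.prob_space)
  from has_bochner_integral_diff[OF unbiased[OF i, of y] this] show ?thesis
    by (simp add: noise_def)
qed

text \<open>The point \<open>Y\<close> is determined by sources other than the sample, so it can be
  frozen, and the variance bound holds at every frozen point with the same constant.\<close>

lemma noise_second_moment:
  assumes i: "i < n" "j < b" and A: "A \<subseteq> src" "Sample k i j \<notin> A"
    and Y: "Y \<in> borel_measurable (gen A)"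
  shows "square_integrable M (\<lambda>w. noise i (\<xi> k i j w) (Y w))"
    and "second_moment M (\<lambda>w. noise i (\<xi> k i j w) (Y w)) \<le> (\<sigma>i i)\<^sup>2"
proof -
  note law = sample_law[OF i, of k]
  have "(\<integral>\<^sup>+w. ennreal ((norm (noise i (\<xi> k i j w) (Y w)))\<^sup>2) \<partial>M)
      = (\<integral>\<^sup>+w. \<integral>\<^sup>+z. ennreal ((norm (noise i z (Y w)))\<^sup>2) \<partial>distr M (\<D> i) (\<xi> k i j) \<partial>M)"
  proof (rule nn_integral_freeze)
    show "indep_set (sets (gen A)) (sets (vimage_algebra (space M) (\<xi> k i j) (\<D> i)))"
      using indep_gen[of A "Sample k i j"] i A by (simp add: source_events_def)
    have [measurable]: "(\<lambda>x. noise i (snd x) (Y (fst x))) \<in> borel_measurable (gen A \<Otimes>\<^sub>M \<D> i)"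
      by (intro noise_measurable_compose i measurable_snd measurable_compose[OF measurable_fst Y])
    show "(\<lambda>(w, z). ennreal ((norm (noise i z (Y w)))\<^sup>2)) \<in> borel_measurable (gen A \<Otimes>\<^sub>M \<D> i)"
      unfolding case_prod_beta' by measurable
  qed (use subalgebra_gen A law in auto)
  also have "\<dots> \<le> (\<integral>\<^sup>+w. ennreal ((\<sigma>i i)\<^sup>2) \<partial>M)"
    unfolding law noise_def
    by (intro nn_integral_mono nn_integral_expectation_le variance i) simp
  finally have *: "(\<integral>\<^sup>+w. ennreal ((norm (noise i (\<xi> k i j w) (Y w)))\<^sup>2) \<partial>M) \<le> ennreal ((\<sigma>i i)\<^sup>2)"
    by (simp add: emeasure_space_1)
  have "(\<lambda>w. noise i (\<xi> k i j w) (Y w)) \<in> borel_measurable M"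
    by (intro noise_measurable_compose i law measurable_gen[OF Y] A)
  from square_integrable_nn_bound[OF this _ *]
  show "square_integrable M (\<lambda>w. noise i (\<xi> k i j w) (Y w))"
    and "second_moment M (\<lambda>w. noise i (\<xi> k i j w) (Y w)) \<le> (\<sigma>i i)\<^sup>2" by simp_all
qed

text \<open>One set \<open>A\<close> has to determine both the point \<open>Y\<close> and the test
  vector \<open>\<psi>\<close>; it may be as large as all the sources but the sample itself.\<close>

lemma noise_orthogonal:
  assumes i: "i < n" "j < b" and A: "A \<subseteq> src" "Sample k i j \<notin> A"
    and Y: "Y \<in> borel_measurable (gen A)"
    and \<psi>: "\<psi> \<in> borel_measurable (gen A)" "square_integrable M \<psi>"
  shows "(\<integral>w. noise i (\<xi> k i j w) (Y w) \<bullet> \<psi> w \<partial>M) = 0"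
proof (rule orthogonal_freeze[where G = "gen A" and T = "\<D> i"])
  note law = sample_law[OF i, of k]
  show "indep_set (sets (gen A)) (sets (vimage_algebra (space M) (\<xi> k i j) (\<D> i)))"
    using indep_gen[of A "Sample k i j"] i A by (simp add: source_events_def)
  have "(\<lambda>x. noise i (snd x) (Y (fst x))) \<in> borel_measurable (gen A \<Otimes>\<^sub>M \<D> i)"
    by (intro noise_measurable_compose i measurable_snd measurable_compose[OF measurable_fst Y])
  then show "(\<lambda>(w, z). noise i z (Y w)) \<in> borel_measurable (gen A \<Otimes>\<^sub>M \<D> i)"
    by (simp add: case_prod_beta')
  show "has_bochner_integral (distr M (\<D> i) (\<xi> k i j)) (\<lambda>z. noise i z (Y w)) 0" for w
    unfolding law by (rule noise_mean[OF i(1)])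
qed (use subalgebra_gen A sample_law[OF i] \<psi> noise_second_moment[OF i A Y] in auto)

lemma quantization_second_moment:
  assumes i: "i < n" and A: "A \<subseteq> src" "Seed k i \<notin> A"
    and Y: "Y \<in> borel_measurable (gen A)" "square_integrable M Y"
  shows "square_integrable M (\<lambda>w. \<Q> (q k i w) (Y w) - Y w)"
    and "second_moment M (\<lambda>w. \<Q> (q k i w) (Y w) - Y w) \<le> \<omega> * second_moment M Y"
proof -
  note law = seed_law[OF i, of k]
  have "(\<integral>\<^sup>+w. ennreal ((norm (\<Q> (q k i w) (Y w) - Y w))\<^sup>2) \<partial>M)
      = (\<integral>\<^sup>+w. \<integral>\<^sup>+s. ennreal ((norm (\<Q> s (Y w) - Y w))\<^sup>2) \<partial>distr M N (q k i) \<partial>M)"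
  proof (rule nn_integral_freeze)
    show "indep_set (sets (gen A)) (sets (vimage_algebra (space M) (q k i) N))"
      using indep_gen[of A "Seed k i"] i A by (simp add: source_events_def)
    have [measurable]: "(\<lambda>x. Y (fst x)) \<in> borel_measurable (gen A \<Otimes>\<^sub>M N)"
      by (rule measurable_compose[OF measurable_fst Y(1)])
    have [measurable]: "(\<lambda>x. \<Q> (snd x) (Y (fst x))) \<in> borel_measurable (gen A \<Otimes>\<^sub>M N)"
      by (intro quantizer_measurable_compose) measurable
    show "(\<lambda>(w, s). ennreal ((norm (\<Q> s (Y w) - Y w))\<^sup>2)) \<in> borel_measurable (gen A \<Otimes>\<^sub>M N)"
      unfolding case_prod_beta' by measurable
  qed (use subalgebra_gen A law in auto)
  also have "\<dots> \<le> (\<integral>\<^sup>+w. ennreal (\<omega> * (norm (Y w))\<^sup>2) \<partial>M)"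
    unfolding law
    by (intro nn_integral_mono nn_integral_expectation_le quantizer_variance) simp
  also have "\<dots> = ennreal (\<omega> * second_moment M Y)"
    using omega_pos square_integrableD[OF Y(2)]
    by (subst nn_integral_eq_integral) (auto simp: second_moment_def)
  finally have *: "(\<integral>\<^sup>+w. ennreal ((norm (\<Q> (q k i w) (Y w) - Y w))\<^sup>2) \<partial>M)
      \<le> ennreal (\<omega> * second_moment M Y)" .
  have "(\<lambda>w. \<Q> (q k i w) (Y w) - Y w) \<in> borel_measurable M"
    by (intro borel_measurable_diff quantizer_measurable_compose law measurable_gen[OF Y(1)] A)
  from square_integrable_nn_bound[OF this _ *] omega_pos second_moment_nonneg[of M Y]
  show "square_integrable M (\<lambda>w. \<Q> (q k i w) (Y w) - Y w)"
    and "second_moment M (\<lambda>w. \<Q> (q k i w) (Y w) - Y w) \<le> \<omega> * second_moment M Y" by simp_all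
qed

lemma quantization_orthogonal:
  assumes i: "i < n" and A: "A \<subseteq> src" "Seed k i \<notin> A"
    and Y: "Y \<in> borel_measurable (gen A)" "square_integrable M Y"
    and \<psi>: "\<psi> \<in> borel_measurable (gen A)" "square_integrable M \<psi>"
  shows "(\<integral>w. (\<Q> (q k i w) (Y w) - Y w) \<bullet> \<psi> w \<partial>M) = 0"
proof (rule orthogonal_freeze[where G = "gen A" and T = N])
  note law = seed_law[OF i, of k]
  show "indep_set (sets (gen A)) (sets (vimage_algebra (space M) (q k i) N))"
    using indep_gen[of A "Seed k i"] i A by (simp add: source_events_def)
  have [measurable]: "(\<lambda>x. Y (fst x)) \<in> borel_measurable (gen A \<Otimes>\<^sub>M N)"
    by (rule measurable_compose[OF measurable_fst Y(1)])
  have [measurable]: "(\<lambda>x. \<Q> (snd x) (Y (fst x))) \<in> borel_measurable (gen A \<Otimes>\<^sub>M N)"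
    by (intro quantizer_measurable_compose) measurable
  show "(\<lambda>(w, s). \<Q> s (Y w) - Y w) \<in> borel_measurable (gen A \<Otimes>\<^sub>M N)"
    unfolding case_prod_beta' by measurable
  show "has_bochner_integral (distr M N (q k i)) (\<lambda>s. \<Q> s (Y w) - Y w) 0" for w
    unfolding law by (rule quantization_error_mean)
qed (use subalgebra_gen A seed_law[OF i] \<psi> quantization_second_moment[OF i A Y] in auto)

text \<open>Both branches must be determined without the coin; freezing them leaves a Bernoulli
  average of two constants.\<close>

lemma coin_expectation:
  fixes Y Z :: "'m \<Rightarrow> real"
  assumes A: "A \<subseteq> src" "Coin k \<notin> A"
    and Y: "Y \<in> borel_measurable (gen A)" "integrable M Y"
    and Z: "Z \<in> borel_measurable (gen A)" "integrable M Z"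
  shows "integrable M (\<lambda>w. if c k w then Y w else Z w)"
    and "(\<integral>w. (if c k w then Y w else Z w) \<partial>M) = p * (\<integral>w. Y w \<partial>M) + (1 - p) * (\<integral>w. Z w \<partial>M)"
proof -
  note [measurable] = coin_law(1)
  show int: "integrable M (\<lambda>w. if c k w then Y w else Z w)"
    by (rule Bochner_Integration.integrable_bound[where f = "\<lambda>w. \<bar>Y w\<bar> + \<bar>Z w\<bar>"])
      (use Y Z in auto)
  have "(\<integral>w. (if c k w then Y w else Z w) \<partial>M) =
      (\<integral>w. (\<integral>s. (if s then Y w else Z w) \<partial>distr M (count_space UNIV) (c k)) \<partial>M)"
  proof (rule integral_freeze[where \<phi> = "\<lambda>w s. if s then Y w else Z w"])
    show "indep_set (sets (gen A)) (sets (vimage_algebra (space M) (c k) (count_space UNIV)))"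
      using indep_gen[of A "Coin k"] A by (simp add: source_events_def)
    have [measurable]: "(\<lambda>x. Y (fst x)) \<in> borel_measurable (gen A \<Otimes>\<^sub>M count_space UNIV)"
        "(\<lambda>x. Z (fst x)) \<in> borel_measurable (gen A \<Otimes>\<^sub>M count_space UNIV)"
      by (rule measurable_compose[OF measurable_fst Y(1)] measurable_compose[OF measurable_fst Z(1)])+
    show "(\<lambda>(w, s). if s then Y w else Z w) \<in> borel_measurable (gen A \<Otimes>\<^sub>M count_space UNIV)"
      unfolding case_prod_beta' by measurable
  qed (use subalgebra_gen A int in auto)
  also have "\<dots> = (\<integral>w. p * Y w + (1 - p) * Z w \<partial>M)"
    unfolding coin_law using p by (simp add: mult.commute)
  finally show "(\<integral>w. (if c k w then Y w else Z w) \<partial>M) = p * (\<integral>w. Y w \<partial>M) + (1 - p) * (\<integral>w. Z w \<partial>M)"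
    using Y Z by simp
qed

subsection \<open>Measurability and integrability of the run\<close>

text \<open>The sources that determine \<open>x k\<close>. This iterate uses the estimators up to
  \<open>gw (k-1) i\<close>, hence samples up to index \<open>k-1\<close> but coins and seeds only
  up to \<open>k-2\<close>, because iteration \<open>k\<close> draws \<open>Coin k\<close> and
  \<open>Seed k i\<close> together with the samples of index \<open>Suc k\<close>. So
  \<open>history (Suc k)\<close>, which determines \<open>g k\<close>, contains no source of
  iteration \<open>k\<close>.\<close>

definition history :: "nat \<Rightarrow> source set" where
  "history k = {s \<in> src. case s of
     Sample k' i j \<Rightarrow> k' < k | Coin k' \<Rightarrow> Suc k' < k | Seed k' i \<Rightarrow> Suc k' < k}"

lemma history_simps [simp]:
  "Sample k' i j \<in> history k \<longleftrightarrow> i < n \<and> j < b \<and> k' < k"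
  "Coin k' \<in> history k \<longleftrightarrow> Suc k' < k"
  "Seed k' i \<in> history k \<longleftrightarrow> i < n \<and> Suc k' < k"
  by (auto simp: history_def)

lemma history_subset: "history k \<subseteq> src"
  by (auto simp: history_def)

lemma history_mono: "k \<le> l \<Longrightarrow> history k \<subseteq> history l"
  by (auto simp: history_def split: source.splits)

lemma
  shows x_0: "x 0 w = x0"
    and gw_0: "i < n \<Longrightarrow> gw 0 i w = minibatch_grad (F i) (\<lambda>j. \<xi> 0 i j w) b (x 0 w)"
    and g_eq: "g k w = (1 / real n) *\<^sub>R (\<Sum>i<n. gw k i w)"
    and x_Suc: "x (Suc k) w = x k w - \<gamma> *\<^sub>R g k w"
    and \<Delta>_eq: "i < n \<Longrightarrow>
      \<Delta> k i w = minibatch_grad_diff (F i) (\<lambda>j. \<xi> (Suc k) i j w) b' (x (Suc k) w) (x k w)"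
    and gw_Suc: "i < n \<Longrightarrow> gw (Suc k) i w =
      (if c k w then minibatch_grad (F i) (\<lambda>j. \<xi> (Suc k) i j w) b (x (Suc k) w)
       else g k w + \<Q> (q k i w) (\<Delta> k i w))"
  using algorithm unfolding vr_marina_online_def by metis+

lemma minibatch_grad_noise:
  "minibatch_grad (F i) z b y = grad (fi i) y + (1 / real b) *\<^sub>R (\<Sum>j<b. noise i (z j) y)"
  using sizes
  by (simp add: minibatch_grad_def noise_def sum_subtractf scaleR_diff_right sum_constant_scaleR del: sum_constant)

lemma minibatch_grad_diff_noise:
  "minibatch_grad_diff (F i) z b' y y' = grad (fi i) y - grad (fi i) y' +
     (1 / real b') *\<^sub>R (\<Sum>j<b'. noise i (z j) y - noise i (z j) y')"
  using sizes
  by (simp add: minibatch_grad_diff_def noise_def sum_subtractf scaleR_diff_right sum_constant_scaleR del: sum_constant)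

lemma minibatch_measurable:
  assumes "i < n" "Y \<in> borel_measurable (gen A)" "\<And>j. j < b \<Longrightarrow> Sample k i j \<in> A"
  shows "(\<lambda>w. minibatch_grad (F i) (\<lambda>j. \<xi> k i j w) b (Y w)) \<in> borel_measurable (gen A)"
  unfolding minibatch_grad_def using assms
  by (intro borel_measurable_scaleR borel_measurable_const borel_measurable_sum
      grad_F_measurable_compose sample_measurable_gen) auto

lemma minibatch_diff_measurable:
  assumes "i < n" "Y \<in> borel_measurable (gen A)" "Y' \<in> borel_measurable (gen A)"
    and "\<And>j. j < b' \<Longrightarrow> Sample k i j \<in> A"
  shows "(\<lambda>w. minibatch_grad_diff (F i) (\<lambda>j. \<xi> k i j w) b' (Y w) (Y' w)) \<in> borel_measurable (gen A)"
  unfolding minibatch_grad_diff_def using assms sizes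
  by (intro borel_measurable_scaleR borel_measurable_const borel_measurable_sum
      borel_measurable_diff grad_F_measurable_compose sample_measurable_gen) auto

text \<open>Iterates and estimators share one induction, since \<open>x (Suc k)\<close> needs
  \<open>gw k i\<close> and \<open>gw (Suc k) i\<close> needs \<open>x (Suc k)\<close>. The
  estimator of index \<open>k\<close> lies one history later than the iterate of that index.\<close>

lemma run_measurable:
  "x k \<in> borel_measurable (gen (history k)) \<and>
   (\<forall>i<n. gw k i \<in> borel_measurable (gen (history (Suc k))))"
proof (induction k)
  case 0
  have x: "x 0 = (\<lambda>_. x0)" using x_0 by auto
  have "gw 0 i \<in> borel_measurable (gen (history (Suc 0)))" if "i < n" for i
    unfolding gw_0[OF that, abs_def]
    using that by (intro minibatch_measurable) (auto simp: x)
  then show ?case by (simp add: x)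
next
  case (Suc k)
  have g[measurable]: "g k \<in> borel_measurable (gen (history (Suc k)))"
    unfolding g_eq[abs_def] using Suc
    by (intro borel_measurable_scaleR borel_measurable_const borel_measurable_sum) auto
  have [measurable]: "x k \<in> borel_measurable (gen (history (Suc k)))"
    using Suc measurable_gen_mono history_mono by (metis lessI less_imp_le)
  have x: "x (Suc k) \<in> borel_measurable (gen (history (Suc k)))"
    unfolding x_Suc[abs_def] by measurable
  have up: "f \<in> borel_measurable (gen (history (Suc (Suc k))))"
    if "f \<in> borel_measurable (gen (history (Suc k)))" for f :: "'m \<Rightarrow> real ^ 'd"
    using that by (rule measurable_gen_mono) (rule history_mono, simp)
  have xk: "x k \<in> borel_measurable (gen (history (Suc k)))" by measurable
  note [measurable] = up[OF x] up[OF xk] up[OF g]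
  have "gw (Suc k) i \<in> borel_measurable (gen (history (Suc (Suc k))))" if i: "i < n" for i
  proof -
    have [measurable]: "\<Delta> k i \<in> borel_measurable (gen (history (Suc (Suc k))))"
      unfolding \<Delta>_eq[OF i, abs_def] using i sizes
      by (intro minibatch_diff_measurable) auto
    have [measurable]: "(\<lambda>w. \<Q> (q k i w) (\<Delta> k i w)) \<in> borel_measurable (gen (history (Suc (Suc k))))"
      using i by (intro quantizer_measurable_compose seed_measurable_gen) auto
    have [measurable]: "(\<lambda>w. minibatch_grad (F i) (\<lambda>j. \<xi> (Suc k) i j w) b (x (Suc k) w))
        \<in> borel_measurable (gen (history (Suc (Suc k))))"
      using i by (intro minibatch_measurable) auto
    have [measurable]: "c k \<in> gen (history (Suc (Suc k))) \<rightarrow>\<^sub>M count_space UNIV"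
      by (rule coin_measurable_gen) simp
    show ?thesis unfolding gw_Suc[OF i, abs_def] by measurable
  qed
  with x show ?case by simp
qed

lemma x_measurable: "history k \<subseteq> A \<Longrightarrow> x k \<in> borel_measurable (gen A)"
  using run_measurable measurable_gen_mono by blast

lemma gw_measurable: "i < n \<Longrightarrow> history (Suc k) \<subseteq> A \<Longrightarrow> gw k i \<in> borel_measurable (gen A)"
  using run_measurable measurable_gen_mono by blast

lemma g_measurable: "history (Suc k) \<subseteq> A \<Longrightarrow> g k \<in> borel_measurable (gen A)"
  unfolding g_eq[abs_def]
  by (intro borel_measurable_scaleR borel_measurable_const borel_measurable_sum gw_measurable) auto

lemma \<Delta>_measurable:
  assumes "i < n" "history (Suc k) \<subseteq> A" "\<And>j. j < b' \<Longrightarrow> Sample (Suc k) i j \<in> A"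
  shows "\<Delta> k i \<in> borel_measurable (gen A)"
  unfolding \<Delta>_eq[OF assms(1), abs_def]
  using assms history_mono[of k "Suc k"]
  by (intro minibatch_diff_measurable x_measurable) auto

lemma grad_fi_square_integrable:
  "i < n \<Longrightarrow> square_integrable M X \<Longrightarrow> square_integrable M (\<lambda>w. grad (fi i) (X w))"
  using smooth unfolding smooth_def by (blast intro: square_integrable_Lipschitz)

lemma noise_history:
  assumes "i < n" "j < b" "history l \<subseteq> history k"
  shows "square_integrable M (\<lambda>w. noise i (\<xi> k i j w) (x l w))"
  by (rule noise_second_moment[OF assms(1,2) history_subset[of k]])
    (use x_measurable assms in auto)

lemma minibatch_square_integrable:
  assumes "i < n" "square_integrable M (x k)"
  shows "square_integrable M (\<lambda>w. minibatch_grad (F i) (\<lambda>j. \<xi> k i j w) b (x k w))"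
  unfolding minibatch_grad_noise using assms
  by (intro square_integrable_add square_integrable_scaleR square_integrable_sum
      grad_fi_square_integrable noise_history) auto

lemma \<Delta>_square_integrable_step:
  assumes "i < n" "square_integrable M (x k)" "square_integrable M (x (Suc k))"
  shows "square_integrable M (\<Delta> k i)"
  unfolding \<Delta>_eq[OF assms(1), abs_def] minibatch_grad_diff_noise using assms sizes
  by (intro square_integrable_add square_integrable_diff square_integrable_scaleR
      square_integrable_sum grad_fi_square_integrable noise_history history_mono) auto

text \<open>Moments propagate through one iteration: gradients are Lipschitz, sample noise has
  bounded variance at any point, and the quantization error costs at most \<open>\<omega>\<close>
  times the second moment of its argument.\<close>

lemma run_square_integrable:
  "square_integrable M (x k) \<and> (\<forall>i<n. square_integrable M (gw k i))"
proof (induction k)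
  case 0
  have x: "square_integrable M (x 0)" by (simp add: x_0[abs_def] square_integrable_const)
  have "square_integrable M (gw 0 i)" if "i < n" for i
    unfolding gw_0[OF that, abs_def] using that x by (rule minibatch_square_integrable)
  with x show ?case by simp
next
  case (Suc k)
  have g: "square_integrable M (g k)"
    unfolding g_eq[abs_def] using Suc
    by (intro square_integrable_scaleR square_integrable_sum) auto
  have x: "square_integrable M (x (Suc k))"
    unfolding x_Suc[abs_def] using Suc g
    by (intro square_integrable_diff square_integrable_scaleR) auto
  have "square_integrable M (gw (Suc k) i)" if i: "i < n" for i
  proof -
    have \<Delta>: "square_integrable M (\<Delta> k i)" using Suc x i by (intro \<Delta>_square_integrable_step) auto
    have "square_integrable M (\<lambda>w. \<Q> (q k i w) (\<Delta> k i w) - \<Delta> k i w)"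
      by (rule quantization_second_moment[where A = "src - {Seed k i}"])
        (use i \<Delta> history_subset[of "Suc k"] sizes in \<open>auto intro!: \<Delta>_measurable\<close>)
    from square_integrable_add[OF this \<Delta>]
    have "square_integrable M (\<lambda>w. \<Q> (q k i w) (\<Delta> k i w))" by simp
    then show ?thesis
      unfolding gw_Suc[OF i, abs_def] using i x g coin_law
      by (intro square_integrable_If square_integrable_add minibatch_square_integrable) auto
  qed
  with x show ?case by simp
qed

lemma x_square_integrable: "square_integrable M (x k)"
  using run_square_integrable by blast

lemma g_square_integrable: "square_integrable M (g k)"
  unfolding g_eq[abs_def] using run_square_integrable
  by (intro square_integrable_scaleR square_integrable_sum) auto

subsection \<open>The error of the gradient estimator\<close>

definition mean_grad :: "real ^ 'd \<Rightarrow> real ^ 'd" where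
  "mean_grad y = (1 / real n) *\<^sub>R (\<Sum>i<n. grad (fi i) y)"

definition estimation_error :: "nat \<Rightarrow> 'm \<Rightarrow> real ^ 'd" where
  "estimation_error k w = g k w - mean_grad (x k w)"

definition mean_noise :: "nat \<Rightarrow> 'm \<Rightarrow> real ^ 'd" where
  "mean_noise k w = (1 / (real n * real b)) *\<^sub>R
     (\<Sum>(i, j)\<in>{..<n} \<times> {..<b}. noise i (\<xi> k i j w) (x k w))"

definition grad_step :: "nat \<Rightarrow> nat \<Rightarrow> 'm \<Rightarrow> real ^ 'd" where
  "grad_step k i w = grad (fi i) (x (Suc k) w) - grad (fi i) (x k w)"

definition quantized_step_error :: "nat \<Rightarrow> nat \<Rightarrow> 'm \<Rightarrow> real ^ 'd" where
  "quantized_step_error k i w = \<Q> (q k i w) (\<Delta> k i w) - grad_step k i w"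

lemma mean_grad_square_integrable: "square_integrable M (\<lambda>w. mean_grad (x k w))"
  unfolding mean_grad_def
  by (intro square_integrable_scaleR square_integrable_sum grad_fi_square_integrable
      x_square_integrable) simp

lemma estimation_error_square_integrable: "square_integrable M (estimation_error k)"
  unfolding estimation_error_def[abs_def]
  by (intro square_integrable_diff g_square_integrable mean_grad_square_integrable)

lemma grad_step_square_integrable: "i < n \<Longrightarrow> square_integrable M (grad_step k i)"
  unfolding grad_step_def[abs_def]
  by (intro square_integrable_diff grad_fi_square_integrable x_square_integrable)

lemma estimation_error_measurable:
  assumes "history (Suc k) \<subseteq> A"
  shows "estimation_error k \<in> borel_measurable (gen A)"
  unfolding estimation_error_def[abs_def] mean_grad_def
  using assms history_mono[of k "Suc k"]
  by (intro borel_measurable_diff g_measurable borel_measurable_scaleR borel_measurable_sum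
      borel_measurable_const measurable_compose[OF x_measurable grad_fi_measurable]) auto

lemma grad_step_measurable:
  assumes "i < n" "history (Suc k) \<subseteq> A"
  shows "grad_step k i \<in> borel_measurable (gen A)"
  unfolding grad_step_def[abs_def]
  using assms history_mono[of k "Suc k"]
  by (intro borel_measurable_diff measurable_compose[OF x_measurable grad_fi_measurable]) auto

lemma quantized_step_error_measurable:
  assumes "i < n" "history (Suc k) \<subseteq> A" "\<And>j. j < b' \<Longrightarrow> Sample (Suc k) i j \<in> A" "Seed k i \<in> A"
  shows "quantized_step_error k i \<in> borel_measurable (gen A)"
  unfolding quantized_step_error_def[abs_def]
  using assms
  by (intro borel_measurable_diff grad_step_measurable quantizer_measurable_compose
      seed_measurable_gen \<Delta>_measurable) auto

lemma mean_noise_measurable: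
  assumes "history k \<subseteq> A" "\<And>i j. i < n \<Longrightarrow> j < b \<Longrightarrow> Sample k i j \<in> A"
  shows "mean_noise k \<in> borel_measurable (gen A)"
  unfolding mean_noise_def[abs_def] case_prod_beta'
  using assms
  by (intro borel_measurable_scaleR borel_measurable_sum borel_measurable_const
      noise_measurable_compose sample_measurable_gen x_measurable) auto

text \<open>The \<open>n b\<close> noises are pairwise orthogonal, so their second moments add, and
  the squared weight \<open>1/(n b)\<close> leaves \<open>\<sigma>\<^sup>2/(n b)\<close>.\<close>

lemma mean_noise_second_moment:
  shows "square_integrable M (mean_noise k)"
    and "second_moment M (mean_noise k) \<le> (1 / real n) * (\<Sum>i<n. (\<sigma>i i)\<^sup>2) / (real n * real b)"
proof -
  let ?I = "{..<n} \<times> {..<b}"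
  let ?X = "\<lambda>r w. noise (fst r) (\<xi> k (fst r) (snd r) w) (x k w)"
  have sq: "square_integrable M (?X r)" if "r \<in> ?I" for r
    using that noise_history by auto
  then show "square_integrable M (mean_noise k)"
    unfolding mean_noise_def[abs_def] case_prod_beta'
    by (intro square_integrable_scaleR square_integrable_sum) auto
  have le: "second_moment M (?X r) \<le> (\<sigma>i (fst r))\<^sup>2" if "r \<in> ?I" for r
    by (rule noise_second_moment(2)[where A = "history k"])
      (use that x_measurable history_subset in auto)
  have "second_moment M (\<lambda>w. \<Sum>r\<in>?I. ?X r w) = (\<Sum>r\<in>?I. second_moment M (?X r))"
  proof (rule second_moment_sum_orthogonal)
    fix r s assume rs: "r \<in> ?I" "s \<in> ?I" "r \<noteq> s"
    \<comment> \<open>The common iterate and the other noise are determined by the remaining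
      sources, so the sample of \<open>r\<close> is fresh for both.\<close>
    show "(\<integral>w. ?X r w \<bullet> ?X s w \<partial>M) = 0"
    proof (rule noise_orthogonal[where A = "src - {Sample k (fst r) (snd r)}"])
      show "x k \<in> borel_measurable (gen (src - {Sample k (fst r) (snd r)}))"
        using history_subset[of k] by (intro x_measurable) auto
      then show "?X s \<in> borel_measurable (gen (src - {Sample k (fst r) (snd r)}))"
        using rs by (intro noise_measurable_compose sample_measurable_gen)
          (auto simp: prod_eq_iff)
    qed (use rs sq in auto)
  qed (use sq in auto)
  also have "\<dots> \<le> (\<Sum>r\<in>?I. (\<sigma>i (fst r))\<^sup>2)" by (intro sum_mono le)
  also have "\<dots> = real b * (\<Sum>i<n. (\<sigma>i i)\<^sup>2)"
    by (simp add: sum.cartesian_product' sum_distrib_left)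
  finally have "second_moment M (mean_noise k) \<le>
      (1 / (real n * real b))\<^sup>2 * (real b * (\<Sum>i<n. (\<sigma>i i)\<^sup>2))"
    unfolding mean_noise_def[abs_def] second_moment_scaleR case_prod_beta'
    by (intro mult_left_mono) auto
  also have "\<dots> = (1 / real n) * (\<Sum>i<n. (\<sigma>i i)\<^sup>2) / (real n * real b)"
    using sizes by (simp add: power2_eq_square divide_simps)
  finally show "second_moment M (mean_noise k) \<le> \<dots>" .
qed

lemma mean_minibatch_grad:
  "(1 / real n) *\<^sub>R (\<Sum>i<n. minibatch_grad (F i) (\<lambda>j. \<xi> k i j w) b (x k w)) - mean_grad (x k w)
     = mean_noise k w"
  by (simp add: minibatch_grad_noise sum.distrib scaleR_add_right mean_grad_def mean_noise_def
      scaleR_sum_right[symmetric] sum.cartesian_product mult.commute)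

lemma estimation_error_0: "estimation_error 0 w = mean_noise 0 w"
  using mean_minibatch_grad[of 0 w] by (simp add: estimation_error_def g_eq gw_0)

text \<open>A full minibatch discards the accumulated error; a compressed round keeps it, because
  every worker starts from the common \<open>g k\<close>, and adds the mean deviation of the
  messages from the true gradient differences.\<close>

lemma estimation_error_Suc:
  "estimation_error (Suc k) w = (if c k w then mean_noise (Suc k) w
     else estimation_error k w + (1 / real n) *\<^sub>R (\<Sum>i<n. quantized_step_error k i w))"
proof (cases "c k w")
  case True
  then show ?thesis
    using mean_minibatch_grad[of "Suc k" w] by (simp add: estimation_error_def g_eq gw_Suc)
next
  case False
  have "g (Suc k) w = (1 / real n) *\<^sub>R (\<Sum>i<n. g k w + \<Q> (q k i w) (\<Delta> k i w))"
    using False by (simp add: g_eq[of "Suc k"] gw_Suc)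
  also have "\<dots> = g k w + (1 / real n) *\<^sub>R (\<Sum>i<n. \<Q> (q k i w) (\<Delta> k i w))"
    using sizes by (simp add: sum.distrib scaleR_add_right sum_constant_scaleR del: sum_constant)
  finally show ?thesis
    using False
    by (simp add: estimation_error_def quantized_step_error_def grad_step_def mean_grad_def
        sum_subtractf scaleR_diff_right)
qed

section \<open>Orthogonality and size of the increments in a compressed round\<close>

lemma \<Delta>_square_integrable: "i < n \<Longrightarrow> square_integrable M (\<Delta> k i)"
  by (intro \<Delta>_square_integrable_step x_square_integrable)

text \<open>\<open>A\<close> omits the whole minibatch of worker \<open>i\<close>, so each of its
  noise terms, at the new and at the old iterate, is fresh for the same
  \<open>\<psi>\<close>.\<close>

lemma minibatch_step_orthogonal:
  assumes i: "i < n" and A: "history (Suc k) \<subseteq> A" "A \<subseteq> src" "\<And>j. j < b' \<Longrightarrow> Sample (Suc k) i j \<notin> A"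
    and \<psi>: "\<psi> \<in> borel_measurable (gen A)" "square_integrable M \<psi>"
  shows "(\<integral>w. (\<Delta> k i w - grad_step k i w) \<bullet> \<psi> w \<partial>M) = 0"
proof -
  let ?X = "\<lambda>l j w. noise i (\<xi> (Suc k) i j w) (x l w)"
  have xm: "x (Suc k) \<in> borel_measurable (gen A)" "x k \<in> borel_measurable (gen A)"
    using A(1) history_mono[of k "Suc k"] by (auto intro!: x_measurable)
  have sq: "square_integrable M (?X (Suc k) j)" "square_integrable M (?X k j)" if "j < b'" for j
    using i that sizes by (auto intro!: noise_history history_mono)
  have orth: "(\<integral>w. (?X (Suc k) j w - ?X k j w) \<bullet> \<psi> w \<partial>M) = 0" if j: "j < b'" for j
  proof -
    have "(\<integral>w. ?X (Suc k) j w \<bullet> \<psi> w \<partial>M) = 0" "(\<integral>w. ?X k j w \<bullet> \<psi> w \<partial>M) = 0"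
      using i j A sizes by (auto intro!: noise_orthogonal[where A = A] xm \<psi>)
    then show ?thesis
      using sq[OF j] \<psi>(2) by (simp add: inner_diff_left integrable_inner_square_integrable)
  qed
  have "(\<integral>w. (\<Sum>j<b'. ?X (Suc k) j w - ?X k j w) \<bullet> \<psi> w \<partial>M) = 0"
    using sq orth \<psi> by (intro orthogonal_sum_left square_integrable_diff) auto
  then show ?thesis
    by (simp add: \<Delta>_eq[OF i] minibatch_grad_diff_noise grad_step_def)
qed

text \<open>The two layers of randomness: quantization noise is centred once the minibatch is fixed,
  minibatch noise is centred once the iterates are fixed.\<close>

lemma quantized_step_error_split:
  "quantized_step_error k i w =
     (\<Q> (q k i w) (\<Delta> k i w) - \<Delta> k i w) + (\<Delta> k i w - grad_step k i w)"
  by (simp add: quantized_step_error_def)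

lemma quantization_part:
  assumes i: "i < n"
  shows "square_integrable M (\<lambda>w. \<Q> (q k i w) (\<Delta> k i w) - \<Delta> k i w)"
    and "second_moment M (\<lambda>w. \<Q> (q k i w) (\<Delta> k i w) - \<Delta> k i w) \<le> \<omega> * second_moment M (\<Delta> k i)"
  using i history_subset[of "Suc k"] sizes
  by (auto intro!: quantization_second_moment[where A = "src - {Seed k i}"] \<Delta>_measurable \<Delta>_square_integrable)

lemma quantization_part_orthogonal:
  assumes i: "i < n" and "\<psi> \<in> borel_measurable (gen (src - {Seed k i}))" "square_integrable M \<psi>"
  shows "(\<integral>w. (\<Q> (q k i w) (\<Delta> k i w) - \<Delta> k i w) \<bullet> \<psi> w \<partial>M) = 0"
  using assms history_subset[of "Suc k"] sizes
  by (auto intro!: quantization_orthogonal[where A = "src - {Seed k i}"] \<Delta>_measurable \<Delta>_square_integrable)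

lemma step_noise_square_integrable:
  "i < n \<Longrightarrow> square_integrable M (\<lambda>w. \<Delta> k i w - grad_step k i w)"
  by (intro square_integrable_diff \<Delta>_square_integrable grad_step_square_integrable)

lemma quantized_step_error_square_integrable:
  "i < n \<Longrightarrow> square_integrable M (quantized_step_error k i)"
  unfolding quantized_step_error_split[abs_def]
  by (intro square_integrable_add quantization_part step_noise_square_integrable)

text \<open>The seed is tested against everything but itself, so the minibatch difference may stay
  random there; the samples are tested against \<open>A\<close>, which omits them as well.\<close>

lemma quantized_step_error_orthogonal:
  assumes i: "i < n" and A: "history (Suc k) \<subseteq> A" "A \<subseteq> src"
      "Seed k i \<notin> A" "\<And>j. j < b' \<Longrightarrow> Sample (Suc k) i j \<notin> A"
    and \<psi>: "\<psi> \<in> borel_measurable (gen A)" "square_integrable M \<psi>"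
  shows "(\<integral>w. quantized_step_error k i w \<bullet> \<psi> w \<partial>M) = 0"
  unfolding quantized_step_error_split
proof (rule orthogonal_add_left)
  have "\<psi> \<in> borel_measurable (gen (src - {Seed k i}))"
    by (rule measurable_gen_mono[OF \<psi>(1)]) (use A in auto)
  then show "(\<integral>w. (\<Q> (q k i w) (\<Delta> k i w) - \<Delta> k i w) \<bullet> \<psi> w \<partial>M) = 0"
    using i \<psi> by (intro quantization_part_orthogonal)
  show "(\<integral>w. (\<Delta> k i w - grad_step k i w) \<bullet> \<psi> w \<partial>M) = 0"
    using i A \<psi> by (intro minibatch_step_orthogonal) auto
qed (use i \<psi> in \<open>auto intro: quantization_part step_noise_square_integrable\<close>)

lemma second_moment_x_diff:
  "second_moment M (\<lambda>w. x (Suc k) w - x k w) = \<gamma>\<^sup>2 * second_moment M (g k)"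
  using second_moment_scaleR[of M "-\<gamma>" "g k"] by (simp add: x_Suc)

lemma grad_step_second_moment:
  assumes i: "i < n"
  shows "second_moment M (grad_step k i) \<le> (Li i)\<^sup>2 * (\<gamma>\<^sup>2 * second_moment M (g k))"
  unfolding second_moment_x_diff[symmetric]
proof (rule second_moment_mono)
  show "norm (grad_step k i w) \<le> Li i * norm (x (Suc k) w - x k w)" for w
    using smooth[OF i] unfolding smooth_def grad_step_def by blast
qed (use i in \<open>auto intro: grad_step_square_integrable square_integrable_diff x_square_integrable\<close>)

text \<open>Average smoothness bounds a conditional second moment; integrating it, that is testing
  the conditional expectation with the constant 1, bounds the unconditional one.\<close>

lemma step_noise_second_moment:
  assumes i: "i < n"
  shows "second_moment M (\<lambda>w. \<Delta> k i w - grad_step k i w)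
           \<le> (\<L>i i)\<^sup>2 / real b' * (\<gamma>\<^sup>2 * second_moment M (g k))"
proof -
  let ?X = "\<lambda>w. \<Delta> k i w - grad_step k i w"
  let ?G = "vimage_algebra (space M) (\<lambda>w. (x k w, x (Suc k) w)) borel"
  have xm[measurable]: "x l \<in> borel_measurable M" for l
    using x_square_integrable by (rule square_integrableD)
  have [measurable]: "?X \<in> borel_measurable M"
    using step_noise_square_integrable[OF i] by (rule square_integrableD)
  have "(\<lambda>w. (x k w, x (Suc k) w)) \<in> M \<rightarrow>\<^sub>M borel" by measurable
  then have "subalgebra M ?G"
    by (simp add: subalgebra_def measurable_iff_sets)
  then interpret G: finite_measure_subalgebra M ?G by unfold_locales
  have le: "AE w in M. nn_cond_exp M ?G (\<lambda>v. ennreal ((norm (?X v))\<^sup>2)) w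
      \<le> ennreal ((\<L>i i)\<^sup>2 / real b' * (norm (x (Suc k) w - x k w))\<^sup>2)"
    using average_smooth i unfolding average_smooth_def Let_def grad_step_def by blast
  have sq: "square_integrable M (\<lambda>w. x (Suc k) w - x k w)"
    by (intro square_integrable_diff x_square_integrable)
  have "(\<integral>\<^sup>+w. ennreal ((norm (?X w))\<^sup>2) \<partial>M)
      = (\<integral>\<^sup>+w. 1 * nn_cond_exp M ?G (\<lambda>v. ennreal ((norm (?X v))\<^sup>2)) w \<partial>M)"
    by (subst G.nn_cond_exp_intg) simp_all
  also have "\<dots> \<le> (\<integral>\<^sup>+w. ennreal ((\<L>i i)\<^sup>2 / real b' * (norm (x (Suc k) w - x k w))\<^sup>2) \<partial>M)"
    using le by (intro nn_integral_mono_AE) simp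
  also have "\<dots> = ennreal ((\<L>i i)\<^sup>2 / real b' * second_moment M (\<lambda>w. x (Suc k) w - x k w))"
    using square_integrableD[OF sq]
    by (subst nn_integral_eq_integral) (auto simp: second_moment_def)
  finally show ?thesis
    unfolding second_moment_x_diff
    by (intro square_integrable_nn_bound) (simp_all add: second_moment_nonneg)
qed

text \<open>Origin of \<open>1 + \<omega>\<close>: minibatch noise counts once by itself and,
  through the second moment of \<open>\<Delta> k i\<close>, another \<open>\<omega>\<close> times in
  the quantization error. The true gradient step is seen only by the quantization error and gets the
  weight \<open>\<omega>\<close>.\<close>

lemma quantized_step_error_second_moment:
  assumes i: "i < n"
  shows "second_moment M (quantized_step_error k i) \<le>
    (\<omega> * (Li i)\<^sup>2 + (1 + \<omega>) * (\<L>i i)\<^sup>2 / real b') * (\<gamma>\<^sup>2 * second_moment M (g k))"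
proof -
  let ?N = "second_moment M (\<lambda>w. \<Delta> k i w - grad_step k i w)"
  have sub: "history (Suc k) \<subseteq> src - {Seed k i}" using history_subset[of "Suc k"] by auto
  have "second_moment M (quantized_step_error k i) =
      second_moment M (\<lambda>w. \<Q> (q k i w) (\<Delta> k i w) - \<Delta> k i w) + ?N"
    unfolding quantized_step_error_split[abs_def]
    using i sub sizes
    by (intro second_moment_add_orthogonal quantization_part step_noise_square_integrable
        quantization_part_orthogonal borel_measurable_diff \<Delta>_measurable grad_step_measurable) auto
  also have "\<dots> \<le> \<omega> * second_moment M (\<Delta> k i) + ?N"
    using quantization_part[OF i] by simp
  also have "second_moment M (\<Delta> k i) =
      second_moment M (\<lambda>w. (\<Delta> k i w - grad_step k i w) + grad_step k i w)" by simp
  also have "\<dots> = ?N + second_moment M (grad_step k i)"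
    using i history_subset[of "Suc k"]
    by (intro second_moment_add_orthogonal step_noise_square_integrable grad_step_square_integrable
        minibatch_step_orthogonal[where A = "history (Suc k)"] grad_step_measurable) auto
  also have "\<omega> * (?N + second_moment M (grad_step k i)) + ?N =
      \<omega> * second_moment M (grad_step k i) + (1 + \<omega>) * ?N" by (simp add: algebra_simps)
  also have "\<dots> \<le> \<omega> * ((Li i)\<^sup>2 * (\<gamma>\<^sup>2 * second_moment M (g k))) +
      (1 + \<omega>) * ((\<L>i i)\<^sup>2 / real b' * (\<gamma>\<^sup>2 * second_moment M (g k)))"
    using omega_pos
    by (intro add_mono mult_left_mono grad_step_second_moment step_noise_second_moment i) auto
  finally show ?thesis by (simp add: algebra_simps)
qed

text \<open>The constant \<open>W\<close> of the overview in terms of the constants of the workers.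
  One factor \<open>1/n\<close> belongs to the means in \<open>L\<^sup>2\<close> and
  \<open>\<L>\<^sup>2\<close>; the other is the variance reduction from \<open>n\<close> orthogonal
  increments.\<close>

definition step_factor :: real where
  "step_factor = (1 / (real n)\<^sup>2) * (\<Sum>i<n. \<omega> * (Li i)\<^sup>2 + (1 + \<omega>) * (\<L>i i)\<^sup>2 / real b')"

text \<open>\<open>B k\<close> is the error after a round without a full minibatch. The past error
  and the increments of the \<open>n\<close> workers are pairwise orthogonal, so their second
  moments add.\<close>

lemma uncompressed_error_second_moment:
  defines "B k \<equiv> \<lambda>w. estimation_error k w + (1 / real n) *\<^sub>R (\<Sum>i<n. quantized_step_error k i w)"
  shows "square_integrable M (B k)"
    and "second_moment M (B k) \<le>
      second_moment M (estimation_error k) + step_factor * (\<gamma>\<^sup>2 * second_moment M (g k))"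
proof -
  let ?Z = "quantized_step_error k"
  \<comment> \<open>Only the seed and the \<open>b'\<close> samples that worker \<open>i\<close>
    uses in a compressed round are removed, which keeps the past error and the increments of all
    other workers measurable.\<close>
  let ?A = "\<lambda>i. src - {Seed k i} - {Sample (Suc k) i j | j. j < b'}"
  have A: "history (Suc k) \<subseteq> ?A i" for i using history_subset[of "Suc k"] by auto
  have sqZ: "square_integrable M (\<lambda>w. (1 / real n) *\<^sub>R (\<Sum>i<n. ?Z i w))"
    by (intro square_integrable_scaleR square_integrable_sum quantized_step_error_square_integrable)
      simp
  then show "square_integrable M (B k)"
    unfolding B_def by (intro square_integrable_add estimation_error_square_integrable)
  have "(\<integral>w. ?Z i w \<bullet> estimation_error k w \<partial>M) = 0" if "i < n" for i
    using that A
    by (intro quantized_step_error_orthogonal[where A = "?A i"] estimation_error_measurable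
        estimation_error_square_integrable) auto
  then have "(\<integral>w. (\<Sum>i<n. ?Z i w) \<bullet> estimation_error k w \<partial>M) = 0"
    by (intro orthogonal_sum_left quantized_step_error_square_integrable
        estimation_error_square_integrable) auto
  then have "(\<integral>w. estimation_error k w \<bullet> ((1 / real n) *\<^sub>R (\<Sum>i<n. ?Z i w)) \<partial>M) = 0"
    by (simp add: inner_commute[of "estimation_error k _"])
  from second_moment_add_orthogonal[OF estimation_error_square_integrable sqZ this]
  have split: "second_moment M (B k) = second_moment M (estimation_error k) +
      (1 / real n)\<^sup>2 * second_moment M (\<lambda>w. \<Sum>i<n. ?Z i w)"
    unfolding B_def by (simp only: second_moment_scaleR)
  have "second_moment M (\<lambda>w. \<Sum>i<n. ?Z i w) = (\<Sum>i<n. second_moment M (?Z i))"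
  proof (rule second_moment_sum_orthogonal)
    fix i l assume il: "i \<in> {..<n}" "l \<in> {..<n}" "i \<noteq> l"
    show "(\<integral>w. ?Z i w \<bullet> ?Z l w \<partial>M) = 0"
      using il A sizes
      by (intro quantized_step_error_orthogonal[where A = "?A i"]
          quantized_step_error_measurable quantized_step_error_square_integrable) auto
  qed (auto intro: quantized_step_error_square_integrable)
  also have "\<dots> \<le> (\<Sum>i<n. (\<omega> * (Li i)\<^sup>2 + (1 + \<omega>) * (\<L>i i)\<^sup>2 / real b') *
      (\<gamma>\<^sup>2 * second_moment M (g k)))"
    by (intro sum_mono quantized_step_error_second_moment) simp
  finally have "(1 / real n)\<^sup>2 * second_moment M (\<lambda>w. \<Sum>i<n. ?Z i w) \<le>
      (1 / real n)\<^sup>2 * \<dots>" by (intro mult_left_mono) auto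
  then show "second_moment M (B k) \<le>
      second_moment M (estimation_error k) + step_factor * (\<gamma>\<^sup>2 * second_moment M (g k))"
    unfolding split by (simp add: step_factor_def sum_distrib_right[symmetric] power_one_over)
qed

section \<open>The error recursion and its sum\<close>

definition noise_level :: real where
  "noise_level = (1 / real n) * (\<Sum>i<n. (\<sigma>i i)\<^sup>2) / (real n * real b)"

lemma error_recursion:
  "second_moment M (estimation_error (Suc k)) \<le> p * noise_level +
     (1 - p) * (second_moment M (estimation_error k) + step_factor * (\<gamma>\<^sup>2 * second_moment M (g k)))"
proof -
  let ?B = "\<lambda>w. estimation_error k w + (1 / real n) *\<^sub>R (\<Sum>i<n. quantized_step_error k i w)"
  let ?A = "src - {Coin k}"
  have A: "history (Suc k) \<subseteq> ?A" using history_subset[of "Suc k"] by auto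
  have [measurable]: "mean_noise (Suc k) \<in> borel_measurable (gen ?A)"
    using A by (intro mean_noise_measurable) auto
  have [measurable]: "?B \<in> borel_measurable (gen ?A)"
    using A sizes
    by (intro borel_measurable_add borel_measurable_scaleR borel_measurable_const
        borel_measurable_sum estimation_error_measurable quantized_step_error_measurable) auto
  have "second_moment M (estimation_error (Suc k)) =
      (\<integral>w. (if c k w then (norm (mean_noise (Suc k) w))\<^sup>2 else (norm (?B w))\<^sup>2) \<partial>M)"
    unfolding second_moment_def estimation_error_Suc by (intro Bochner_Integration.integral_cong) auto
  also have "\<dots> = p * second_moment M (mean_noise (Suc k)) + (1 - p) * second_moment M ?B"
    unfolding second_moment_def
    by (rule coin_expectation[where A = ?A])
      (use mean_noise_second_moment uncompressed_error_second_moment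
        in \<open>auto dest: square_integrableD(2)\<close>)
  also have "\<dots> \<le> p * noise_level +
     (1 - p) * (second_moment M (estimation_error k) + step_factor * (\<gamma>\<^sup>2 * second_moment M (g k)))"
    unfolding noise_level_def
    using p by (intro add_mono mult_left_mono mean_noise_second_moment
        uncompressed_error_second_moment) auto
  finally show ?thesis .
qed

text \<open>Rewritten as \<open>V (k+1) + p V k \<le> V k + ...\<close>, the recursion telescopes.
  The induction needs the last \<open>V K\<close> on the left side; it is dropped afterwards by
  nonnegativity.\<close>

lemma error_sum:
  "p * (\<Sum>k<K. second_moment M (estimation_error k)) \<le> noise_level + real K * (p * noise_level) +
     (1 - p) * step_factor * \<gamma>\<^sup>2 * (\<Sum>k<K. second_moment M (g k))"
proof -
  let ?V = "\<lambda>k. second_moment M (estimation_error k)"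
  have "p * (\<Sum>k<K. ?V k) + ?V K \<le> noise_level + real K * (p * noise_level) +
     (1 - p) * step_factor * \<gamma>\<^sup>2 * (\<Sum>k<K. second_moment M (g k))"
  proof (induction K)
    case 0
    have "?V 0 \<le> noise_level"
      unfolding estimation_error_0[abs_def] noise_level_def by (rule mean_noise_second_moment)
    then show ?case by simp
  next
    case (Suc K)
    with error_recursion[of K] show ?case by (simp add: algebra_simps)
  qed
  with second_moment_nonneg[of M "estimation_error K"] show ?thesis by linarith
qed

subsection \<open>Descent\<close>

text \<open>The descent inequality is telescoped along each trajectory and only then integrated, so that
  integrability of the function values along the run is not needed.\<close>

lemma descent_sum:
  assumes smooth_f: "smooth L f" and grad_f: "\<And>y. grad f y = mean_grad y"
    and lower: "\<And>y. f y \<ge> fstar"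
  shows "\<gamma> / 2 * (\<Sum>k<K. second_moment M (\<lambda>w. grad f (x k w))) +
      \<gamma> / 2 * (1 - L * \<gamma>) * (\<Sum>k<K. second_moment M (g k))
    \<le> f x0 - fstar + \<gamma> / 2 * (\<Sum>k<K. second_moment M (estimation_error k))"
proof -
  let ?h = "\<lambda>w. \<gamma> / 2 * (\<Sum>k<K. (norm (grad f (x k w)))\<^sup>2) +
      \<gamma> / 2 * (1 - L * \<gamma>) * (\<Sum>k<K. (norm (g k w))\<^sup>2) -
      \<gamma> / 2 * (\<Sum>k<K. (norm (estimation_error k w))\<^sup>2)"
  have "f (x K w) \<le> f x0 - ?h w" for w
  proof (induction K)
    case (Suc K)
    with descent_step[OF smooth_f, of "x K w" \<gamma> "g K w"] show ?case
      by (simp add: x_Suc estimation_error_def grad_f algebra_simps)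
  qed (simp add: x_0)
  then have "fstar \<le> f x0 - ?h w" for w using lower[of "x K w"] order_trans by blast
  then have le: "?h w \<le> f x0 - fstar" for w by (simp only: le_diff_eq add.commute)
  have [simp]: "integrable M (\<lambda>w. (norm (grad f (x k w)))\<^sup>2)" "integrable M (\<lambda>w. (norm (g k w))\<^sup>2)"
      "integrable M (\<lambda>w. (norm (estimation_error k w))\<^sup>2)" for k
    unfolding grad_f
    using mean_grad_square_integrable g_square_integrable estimation_error_square_integrable
    by (auto dest: square_integrableD(2))
  have "(\<integral>w. ?h w \<partial>M) \<le> (\<integral>w. f x0 - fstar \<partial>M)"
    by (intro integral_mono le) auto
  also have "\<dots> = f x0 - fstar" by (simp add: prob_space)
  also have "(\<integral>w. ?h w \<partial>M) = \<gamma> / 2 * (\<Sum>k<K. second_moment M (\<lambda>w. grad f (x k w))) +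
      \<gamma> / 2 * (1 - L * \<gamma>) * (\<Sum>k<K. second_moment M (g k)) -
      \<gamma> / 2 * (\<Sum>k<K. second_moment M (estimation_error k))"
    by (simp add: second_moment_def Bochner_Integration.integral_sum)
  finally show ?thesis by simp
qed

lemma gradient_bound:
  assumes smooth_f: "smooth L f" and grad_f: "\<And>y. grad f y = mean_grad y"
    and lower: "\<And>y. f y \<ge> fstar"
    and step: "0 < \<gamma>" "L * \<gamma> + (1 - p) / p * step_factor * \<gamma>\<^sup>2 \<le> 1" and p_pos: "0 < p"
  shows "(\<Sum>k<K. second_moment M (\<lambda>w. grad f (x k w))) \<le>
    2 * (f x0 - fstar) / \<gamma> + noise_level / p + real K * noise_level"
proof -
  let ?N = "\<Sum>k<K. second_moment M (\<lambda>w. grad f (x k w))"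
  let ?G = "\<Sum>k<K. second_moment M (g k)"
  let ?V = "\<Sum>k<K. second_moment M (estimation_error k)"
  have divide_p: "v \<le> N / p + K * N + (1 - p) / p * s * r * G"
    if "p * v \<le> N + K * (p * N) + (1 - p) * s * r * G" for v N K s r G :: real
  proof -
    have "p * v \<le> p * (N / p + K * N + (1 - p) / p * s * r * G)"
      using that p_pos by (simp add: distrib_left mult.left_commute[of p K])
    with p_pos show ?thesis by simp
  qed
  have divide_\<gamma>: "s + a * r \<le> 2 * t / \<gamma> + v"
    if "\<gamma> / 2 * s + \<gamma> / 2 * a * r \<le> t + \<gamma> / 2 * v" for s a r t v :: real
  proof -
    have "\<gamma> / 2 * (s + a * r) \<le> \<gamma> / 2 * (2 * t / \<gamma> + v)"
      using that step(1) by (simp add: distrib_left)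
    with step(1) show ?thesis by (simp add: mult_le_cancel_left_pos)
  qed
  note divide_p[OF error_sum[of K]]
  \<comment> \<open>The stepsize condition in the form used: the weight
    \<open>1 - L \<gamma>\<close> that descent puts on the second moments of \<open>g k\<close>
    dominates the weight contributed by the errors.\<close>
  moreover have "(L * \<gamma> + (1 - p) / p * step_factor * \<gamma>\<^sup>2) * ?G \<le> 1 * ?G"
    using step by (intro mult_right_mono sum_nonneg second_moment_nonneg)
  moreover note divide_\<gamma>[OF descent_sum[OF smooth_f grad_f lower, of K]]
  ultimately show ?thesis unfolding distrib_right left_diff_distrib by linarith
qed

subsection \<open>Expected costs and the random output\<close>

lemma expected_nnz_quantized:
  assumes i: "i < n"
  shows "(\<integral>w. real (nnz (\<Q> (q k i w) (\<Delta> k i w))) \<partial>M) \<le> expected_density N \<Q>"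
proof -
  let ?A = "src - {Seed k i}"
  note law = seed_law[OF i, of k]
  have \<Delta>: "\<Delta> k i \<in> borel_measurable (gen ?A)"
    using i history_subset[of "Suc k"] sizes by (intro \<Delta>_measurable) auto
  have Q: "(\<lambda>w. \<Q> (q k i w) (\<Delta> k i w)) \<in> borel_measurable M"
    by (intro quantizer_measurable_compose law measurable_gen[OF \<Delta>]) auto
  have "(\<integral>w. real (nnz (\<Q> (q k i w) (\<Delta> k i w))) \<partial>M) =
      (\<integral>w. (\<integral>s. real (nnz (\<Q> s (\<Delta> k i w))) \<partial>distr M N (q k i)) \<partial>M)"
  proof (rule integral_freeze[where G = "gen ?A"])
    show "indep_set (sets (gen ?A)) (sets (vimage_algebra (space M) (q k i) N))"
      using indep_gen[of ?A "Seed k i"] i by (simp add: source_events_def)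
    have "(\<lambda>x. \<Q> (snd x) (\<Delta> k i (fst x))) \<in> borel_measurable (gen ?A \<Otimes>\<^sub>M N)"
      by (intro quantizer_measurable_compose measurable_snd measurable_compose[OF measurable_fst \<Delta>])
    from measurable_compose[OF this borel_measurable_nnz]
    show "(\<lambda>(w, s). real (nnz (\<Q> s (\<Delta> k i w)))) \<in> borel_measurable (gen ?A \<Otimes>\<^sub>M N)"
      by (simp add: case_prod_beta')
  qed (use subalgebra_gen law integrable_nnz[OF prob_space_axioms Q] in auto)
  also have "\<dots> \<le> (\<integral>w. expected_density N \<Q> \<partial>M)"
  proof (cases "integrable M (\<lambda>w. \<integral>s. real (nnz (\<Q> s (\<Delta> k i w))) \<partial>N)")
    case True
    then show ?thesis unfolding law using expected_nnz_le_density by (intro integral_mono) auto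
  next
    \<comment> \<open>A non-integrable inner integral would make the outer one 0, and the density is
      positive.\<close>
    case False
    then show ?thesis
      unfolding law using expected_density_pos by (simp add: not_integrable_integral_eq prob_space)
  qed
  finally show ?thesis by (simp add: prob_space)
qed

lemma communication_round:
  assumes i: "i < n"
  defines "v k w \<equiv> if c k w then gw (Suc k) i w else \<Q> (q k i w) (\<Delta> k i w)"
  shows "integrable M (\<lambda>w. real (nnz (v k w)))"
    and "(\<integral>w. real (nnz (v k w)) \<partial>M) \<le> p * real CARD('d) + (1 - p) * expected_density N \<Q>"
proof -
  let ?A = "src - {Coin k}"
  let ?Q = "\<lambda>w. \<Q> (q k i w) (\<Delta> k i w)"
  have \<Delta>: "?Q \<in> borel_measurable (gen ?A)"
    using i history_subset[of "Suc k"] sizes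
    by (intro quantizer_measurable_compose seed_measurable_gen \<Delta>_measurable) auto
  have Q[measurable]: "?Q \<in> borel_measurable M" using \<Delta> by (rule measurable_gen) auto
  have [measurable]: "gw (Suc k) i \<in> borel_measurable M"
    using run_square_integrable i by (auto dest: square_integrableD)
  note [measurable] = coin_law(1)
  have "v k \<in> borel_measurable M" unfolding v_def by measurable
  then show int: "integrable M (\<lambda>w. real (nnz (v k w)))"
    by (intro integrable_nnz prob_space_axioms)
  \<comment> \<open>\<open>gw (Suc k) i\<close> itself depends on the coin, so it is bounded by the
    dimension before the coin is integrated out.\<close>
  have coin: "integrable M (\<lambda>w. if c k w then real CARD('d) else real (nnz (?Q w)))"
    "(\<integral>w. (if c k w then real CARD('d) else real (nnz (?Q w))) \<partial>M) =
      p * (\<integral>w. real CARD('d) \<partial>M) + (1 - p) * (\<integral>w. real (nnz (?Q w)) \<partial>M)"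
    by (rule coin_expectation[where A = ?A];
        use measurable_compose[OF \<Delta> borel_measurable_nnz] integrable_nnz[OF prob_space_axioms Q]
        in simp)+
  have "(\<integral>w. real (nnz (v k w)) \<partial>M) \<le>
      (\<integral>w. (if c k w then real CARD('d) else real (nnz (?Q w))) \<partial>M)"
    by (intro integral_mono int coin) (auto simp: v_def nnz_le)
  also have "\<dots> \<le> p * real CARD('d) + (1 - p) * expected_density N \<Q>"
    unfolding coin using p expected_nnz_quantized[OF i, of k]
    by (auto simp: prob_space intro!: mult_left_mono)
  finally show "(\<integral>w. real (nnz (v k w)) \<partial>M) \<le> p * real CARD('d) + (1 - p) * expected_density N \<Q>" .
qed

lemma communication_cost_le:
  assumes i: "i < n" and cost: "\<kappa> > 0" "\<And>v. cost v = \<kappa> * real (nnz v)"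
  shows "expectation_le M (communication_cost cost \<Q> c q gw \<Delta> i K)
    (\<kappa> * (real CARD('d) + real K * (p * real CARD('d) + (1 - p) * expected_density N \<Q>)))"
proof -
  let ?v = "\<lambda>k w. if c k w then gw (Suc k) i w else \<Q> (q k i w) (\<Delta> k i w)"
  have gw: "gw 0 i \<in> borel_measurable M"
    using run_square_integrable i by (auto dest: square_integrableD)
  note int = integrable_nnz[OF prob_space_axioms gw] communication_round(1)[OF i]
  have eq: "communication_cost cost \<Q> c q gw \<Delta> i K =
      (\<lambda>w. \<kappa> * (real (nnz (gw 0 i w)) + (\<Sum>k<K. real (nnz (?v k w)))))"
    by (simp add: communication_cost_def[abs_def] cost distrib_left sum_distrib_left)
  have gw0: "(\<integral>w. real (nnz (gw 0 i w)) \<partial>M) \<le> real CARD('d)"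
    using int(1) nnz_le by (intro integral_le_const) auto
  have "(\<integral>w. real (nnz (gw 0 i w)) + (\<Sum>k<K. real (nnz (?v k w))) \<partial>M) =
      (\<integral>w. real (nnz (gw 0 i w)) \<partial>M) + (\<Sum>k<K. (\<integral>w. real (nnz (?v k w)) \<partial>M))"
    using int by (simp add: Bochner_Integration.integral_sum)
  also have "\<dots> \<le> real CARD('d) +
      (\<Sum>k<K. p * real CARD('d) + (1 - p) * expected_density N \<Q>)"
    by (intro add_mono gw0 sum_mono communication_round i)
  finally show ?thesis
    unfolding expectation_le_def eq using cost(1) int by (simp add: mult_left_mono)
qed

lemma oracle_calls_le:
  "expectation_le M (oracle_calls b b' c K)
    (real b + real K * (p * real b + (1 - p) * (2 * real b')))"
proof -
  let ?v = "\<lambda>k w. if c k w then real b else 2 * real b'"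
  have coin: "integrable M (?v k)" "(\<integral>w. ?v k w \<partial>M) = p * real b + (1 - p) * (2 * real b')" for k
  proof -
    have const: "(\<integral>w. a \<partial>M) = a" for a :: real by (simp add: prob_space)
    show "integrable M (?v k)"
      by (rule coin_expectation(1)[where A = "{}"]) auto
    have "(\<integral>w. ?v k w \<partial>M) = p * (\<integral>w. real b \<partial>M) + (1 - p) * (\<integral>w. 2 * real b' \<partial>M)"
      by (rule coin_expectation(2)[where A = "{}"]) auto
    then show "(\<integral>w. ?v k w \<partial>M) = p * real b + (1 - p) * (2 * real b')" unfolding const .
  qed
  have sum: "integrable M (\<lambda>w. \<Sum>k<K. ?v k w)"
    by (intro Bochner_Integration.integrable_sum coin)
  have "(\<integral>w. real b + (\<Sum>k<K. ?v k w) \<partial>M) = real b + (\<integral>w. (\<Sum>k<K. ?v k w) \<partial>M)"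
    by (subst Bochner_Integration.integral_add[OF _ sum]) (simp_all add: prob_space)
  also have "(\<integral>w. (\<Sum>k<K. ?v k w) \<partial>M) = (\<Sum>k<K. \<integral>w. ?v k w \<partial>M)"
    by (rule Bochner_Integration.integral_sum) (rule coin)
  also have "\<dots> = real K * (p * real b + (1 - p) * (2 * real b'))"
    unfolding coin by simp
  finally show ?thesis
    unfolding expectation_le_def oracle_calls_def[abs_def] using sum by auto
qed

text \<open>The uniform index turns the inner integral into an average over the trajectory, and
  Fubini turns the expectation at the random output into the mean of the expectations at the
  iterates.\<close>

lemma output_expectation:
  fixes h :: "real ^ 'd \<Rightarrow> real"
  assumes K: "K \<ge> 1" and h: "h \<in> borel_measurable borel" "\<And>y. 0 \<le> h y"
    and int: "\<And>k. integrable M (\<lambda>w. h (x k w))"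
    and bound: "(\<Sum>k<K. \<integral>w. h (x k w) \<partial>M) \<le> real K * B"
  shows "expectation_le (output_space M K) (\<lambda>o'. h (output_point x o')) B"
proof -
  let ?U = "measure_pmf (pmf_of_set {..<K})"
  have K': "{..<K} \<noteq> {}" using K by (simp add: lessThan_empty_iff)
  interpret U: prob_space ?U by (rule prob_space_measure_pmf)
  interpret MU: pair_prob_space M ?U ..
  have xm: "x k \<in> borel_measurable M" for k
    using x_square_integrable by (rule square_integrableD)
  have [measurable]: "(\<lambda>o'. h (output_point x o')) \<in> borel_measurable (M \<Otimes>\<^sub>M ?U)"
  proof -
    have "(\<lambda>o'. h (x (snd o') (fst o'))) \<in> borel_measurable (M \<Otimes>\<^sub>M ?U)"
      by (rule measurable_compose_countable[where f = "\<lambda>k o'. h (x k (fst o'))" and g = snd])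
        (auto intro: measurable_compose[OF measurable_compose[OF measurable_fst xm] h(1)])
    then show ?thesis by (simp add: output_point_def case_prod_beta')
  qed
  have inner: "(\<integral>k. h (output_point x (w, k)) \<partial>?U) = (\<Sum>k<K. h (x k w)) / real K" for w
    using K' by (simp add: output_point_def integral_pmf_of_set)
  have int': "integrable (M \<Otimes>\<^sub>M ?U) (\<lambda>o'. h (output_point x o'))"
  proof (rule MU.Fubini_integrable)
    show "integrable M (\<lambda>w. \<integral>k. norm (h (output_point x (w, k))) \<partial>?U)"
      using int h(2) by (simp add: inner)
    show "AE w in M. integrable ?U (\<lambda>k. h (output_point x (w, k)))"
      using K' by (intro AE_I2 integrable_measure_pmf_finite) simp
  qed measurable
  have "(\<integral>o'. h (output_point x o') \<partial>(M \<Otimes>\<^sub>M ?U)) =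
      (\<integral>w. (\<integral>k. h (output_point x (w, k)) \<partial>?U) \<partial>M)"
    using MU.integral_fst'[OF int'] by simp
  also have "\<dots> = (\<Sum>k<K. \<integral>w. h (x k w) \<partial>M) / real K"
    unfolding inner using int by (simp add: Bochner_Integration.integral_sum)
  also have "\<dots> \<le> B" using bound K by (simp add: divide_simps mult.commute)
  finally show ?thesis
    using int' unfolding expectation_le_def output_space_def by simp
qed

end

subsection \<open>The number of iterations\<close>

text \<open>Inverting the minimum gives a maximum, and \<open>(1 - p)/p = 1/p - 1\<close>. The last
  two bounds hold because \<open>p\<close> lies below each term of the minimum: full rounds, met
  with probability \<open>p\<close>, contribute on average at most \<open>\<zeta>\<close> components
  and \<open>b'\<close> oracle calls.\<close>

lemma min_probability:
  fixes \<zeta> d b b' :: real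
  assumes "0 < \<zeta>" "0 < d" "0 < b" "0 < b'"
  defines "p \<equiv> min (\<zeta> / d) (b' / (b + b'))"
  shows "0 < p" "p \<le> 1" "1 / p = max (d / \<zeta>) (1 + b / b')"
    "(1 - p) / p = max (d / \<zeta> - 1) (b / b')" "p * d \<le> \<zeta>" "p * b \<le> b'"
proof -
  show pos: "0 < p" using assms by simp
  have "b' / (b + b') \<le> 1" using assms by simp
  then show "p \<le> 1" by (simp add: p_def min_le_iff_disj)
  have "p \<le> \<zeta> / d" by (simp add: p_def)
  then show "p * d \<le> \<zeta>" using assms(2) by (simp only: pos_le_divide_eq)
  have "p \<le> b' / (b + b')" "0 < b + b'" using assms by (simp_all add: p_def)
  then have "p * (b + b') \<le> b'" by (simp only: pos_le_divide_eq)
  moreover have "0 \<le> p * b'" using pos assms by simp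
  ultimately show "p * b \<le> b'" by (simp add: distrib_left)
  have inv: "1 / (b' / (b + b')) = 1 + b / b'" using assms by (simp add: field_simps)
  show eq: "1 / p = max (d / \<zeta>) (1 + b / b')"
  proof (cases "\<zeta> / d \<le> b' / (b + b')")
    case True
    then have "1 / (b' / (b + b')) \<le> 1 / (\<zeta> / d)"
      using assms by (intro divide_left_mono) auto
    with True inv show ?thesis by (simp add: p_def)
  next
    case False
    then have "1 / (\<zeta> / d) \<le> 1 / (b' / (b + b'))"
      using assms by (intro divide_left_mono) auto
    with False inv show ?thesis by (simp add: p_def)
  qed
  have "(1 - p) / p = 1 / p - 1" using pos by (simp add: diff_divide_distrib)
  then show "(1 - p) / p = max (d / \<zeta> - 1) (b / b')" unfolding eq by (simp add: max_def)
qed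

text \<open>With \<open>u = \<gamma> * sqrt X\<close> the hypotheses force
  \<open>0 \<le> u \<le> 1\<close>, so \<open>u\<^sup>2 \<le> u\<close>.\<close>

lemma stepsize_condition:
  fixes L X \<gamma> :: real
  assumes "0 \<le> L" "0 \<le> X" "0 < \<gamma>" "\<gamma> * (L + sqrt X) \<le> 1"
  shows "L * \<gamma> + X * \<gamma>\<^sup>2 \<le> 1"
proof -
  have "0 \<le> \<gamma> * L" "0 \<le> \<gamma> * sqrt X" using assms by simp_all
  then have "\<gamma> * sqrt X \<le> 1" using assms(4) by (simp add: distrib_left)
  then have "(\<gamma> * sqrt X) * (\<gamma> * sqrt X) \<le> 1 * (\<gamma> * sqrt X)"
    using \<open>0 \<le> \<gamma> * sqrt X\<close> by (intro mult_right_mono)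
  moreover have "(\<gamma> * sqrt X) * (\<gamma> * sqrt X) = X * \<gamma>\<^sup>2"
    using assms(2) by (simp add: power2_eq_square algebra_simps)
  ultimately show ?thesis using assms(4) by (simp add: algebra_simps)
qed

text \<open>Passes from the stepsize denominator, written with \<open>b\<close>, to the bracket of
  the complexity bounds, written with \<open>\<sigma>\<^sup>2/(n \<epsilon>\<^sup>2)\<close>. It
  rests on subadditivity of the square root and on \<open>c2 \<le> c2\<^sup>2\<close>;
  \<open>Y\<close> stands for the maximum with \<open>b/b'\<close> and \<open>R\<close> for its
  counterpart with the target accuracy.\<close>

lemma stepsize_denominator_le:
  fixes L \<L> \<omega> n b' c2 R Y :: real
  assumes "0 \<le> L" "0 \<le> \<L>" "0 \<le> \<omega>" "0 < n" "0 < b'" "1 \<le> c2" "0 \<le> R" "Y \<le> c2 * R"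
  shows "L + sqrt (Y / n * (\<omega> * L\<^sup>2 + (1 + \<omega>) * \<L>\<^sup>2 / b')) \<le>
    c2 * (L * (1 + sqrt (\<omega> / n * R)) + \<L> * sqrt ((1 + \<omega>) / (n * b') * R))"
proof -
  let ?u = "\<omega> / n * R" and ?v = "(1 + \<omega>) / (n * b') * R"
  have uv: "0 \<le> ?u" "0 \<le> ?v" using assms by simp_all
  have nn: "0 \<le> L * sqrt ?u + \<L> * sqrt ?v" using assms uv by simp
  have "Y / n * (\<omega> * L\<^sup>2 + (1 + \<omega>) * \<L>\<^sup>2 / b') \<le> c2 * R / n * (\<omega> * L\<^sup>2 + (1 + \<omega>) * \<L>\<^sup>2 / b')"
    using assms by (intro mult_right_mono divide_right_mono) auto
  also have "\<dots> = c2 * (L\<^sup>2 * ?u + \<L>\<^sup>2 * ?v)"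
    using assms by (simp add: field_simps)
  also have "\<dots> \<le> c2\<^sup>2 * (L * sqrt ?u + \<L> * sqrt ?v)\<^sup>2"
  proof (rule mult_mono)
    show "c2 \<le> c2\<^sup>2" using assms(6) by (simp add: power2_eq_square)
    have "0 \<le> 2 * (L * sqrt ?u) * (\<L> * sqrt ?v)" using assms uv by simp
    then show "L\<^sup>2 * ?u + \<L>\<^sup>2 * ?v \<le> (L * sqrt ?u + \<L> * sqrt ?v)\<^sup>2"
      using uv by (simp only: power2_sum power_mult_distrib real_sqrt_pow2)
  qed (use assms uv in auto)
  finally have "Y / n * (\<omega> * L\<^sup>2 + (1 + \<omega>) * \<L>\<^sup>2 / b') \<le> (c2 * (L * sqrt ?u + \<L> * sqrt ?v))\<^sup>2"
    by (simp only: power_mult_distrib)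
  then have "sqrt (Y / n * (\<omega> * L\<^sup>2 + (1 + \<omega>) * \<L>\<^sup>2 / b')) \<le> c2 * (L * sqrt ?u + \<L> * sqrt ?v)"
    using nn assms by (intro real_le_lsqrt) auto
  moreover have "L \<le> c2 * L" using assms by (simp add: mult_le_cancel_right1)
  ultimately show ?thesis by (simp add: algebra_simps)
qed

text \<open>A residual \<open>\<eta> \<le> \<epsilon>\<^sup>2/c1\<close> leaves the share
  \<open>(1 - 1/c1) \<epsilon>\<^sup>2\<close> per iteration to pay for the terms that do not grow
  with \<open>K\<close>; this is where \<open>c1 > 1\<close> is spent, and where
  \<open>c1 - 1\<close> in the denominator of the constant comes from.\<close>

lemma iteration_count:
  fixes c1 c2 \<tau> \<gamma> \<epsilon> p \<Delta>0 T \<Lambda> den \<eta> :: real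
  assumes "1 < c1" "c1 \<le> c2" "0 < \<tau>" "\<tau> \<le> 1" "0 < \<gamma>" "0 < \<epsilon>" "0 < p" "0 \<le> \<Delta>0" "1 \<le> T"
    and p: "1 / p \<le> 2 * c2 * T" and den: "\<tau> / den \<le> \<gamma>" "0 < den" "den \<le> c2 * \<Lambda>"
    and \<eta>: "\<eta> \<le> \<epsilon>\<^sup>2 / c1"
  obtains K :: nat where "K \<ge> 1" "2 * \<Delta>0 / \<gamma> + \<eta> / p + real K * \<eta> \<le> real K * \<epsilon>\<^sup>2"
    "real K \<le> 3 * (c1 * c2 / ((c1 - 1) * \<tau>)) * (T + \<Delta>0 / \<epsilon>\<^sup>2 * \<Lambda>)"
proof -
  define C where "C = c1 * c2 / ((c1 - 1) * \<tau>)"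
  \<comment> \<open>The real number of iterations for which the budget is met exactly when
    \<open>\<eta> = \<epsilon>\<^sup>2/c1\<close>; \<open>K\<close> is its ceiling.\<close>
  define Y where "Y = 2 * c1 * \<Delta>0 / ((c1 - 1) * \<gamma> * \<epsilon>\<^sup>2) + 1 / ((c1 - 1) * p)"
  define K where "K = nat \<lceil>Y\<rceil>"
  have "0 \<le> 2 * c1 * \<Delta>0 / ((c1 - 1) * \<gamma> * \<epsilon>\<^sup>2)" "0 < 1 / ((c1 - 1) * p)" using assms by simp_all
  then have Y: "0 < Y" unfolding Y_def by linarith
  then have "K \<ge> 1" "Y \<le> real K" "real K \<le> Y + 1"
    unfolding K_def by linarith+
  have E: "0 < (c1 - 1) / c1 * \<epsilon>\<^sup>2" using assms by simp
  have "2 * \<Delta>0 / \<gamma> + \<epsilon>\<^sup>2 / c1 / p = (c1 - 1) / c1 * \<epsilon>\<^sup>2 * Y"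
  proof -
    have nz: "c1 \<noteq> 0" "c1 - 1 \<noteq> 0" "\<epsilon> \<noteq> 0" "\<gamma> \<noteq> 0" "p \<noteq> 0" using assms by auto
    have "(c1 - 1) / c1 * \<epsilon>\<^sup>2 * (2 * c1 * \<Delta>0 / ((c1 - 1) * \<gamma> * \<epsilon>\<^sup>2)) = 2 * \<Delta>0 / \<gamma>"
      using nz by (simp add: divide_simps)
    moreover have "(c1 - 1) / c1 * \<epsilon>\<^sup>2 * (1 / ((c1 - 1) * p)) = \<epsilon>\<^sup>2 / c1 / p"
      using nz by (simp add: divide_simps)
    ultimately show ?thesis by (simp only: Y_def distrib_left)
  qed
  also have "\<dots> \<le> (c1 - 1) / c1 * \<epsilon>\<^sup>2 * real K"
    using E \<open>Y \<le> real K\<close> by (intro mult_left_mono) auto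
  also have "\<dots> = real K * \<epsilon>\<^sup>2 - real K * (\<epsilon>\<^sup>2 / c1)" using assms by (simp add: field_simps)
  finally have "2 * \<Delta>0 / \<gamma> + \<epsilon>\<^sup>2 / c1 / p + real K * (\<epsilon>\<^sup>2 / c1) \<le> real K * \<epsilon>\<^sup>2" by simp
  moreover have "\<eta> / p \<le> \<epsilon>\<^sup>2 / c1 / p" "real K * \<eta> \<le> real K * (\<epsilon>\<^sup>2 / c1)"
    using \<eta> \<open>0 < p\<close> by (intro divide_right_mono mult_left_mono; simp)+
  ultimately have bound: "2 * \<Delta>0 / \<gamma> + \<eta> / p + real K * \<eta> \<le> real K * \<epsilon>\<^sup>2" by linarith
  have inv: "1 / \<gamma> \<le> c2 * \<Lambda> / \<tau>"
  proof -
    have "\<tau> \<le> \<gamma> * den" using den by (simp add: pos_divide_le_eq)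
    then have "1 / \<gamma> \<le> den / \<tau>" using assms by (simp add: field_simps)
    also have "\<dots> \<le> c2 * \<Lambda> / \<tau>" using den assms by (intro divide_right_mono) auto
    finally show ?thesis .
  qed
  have "2 * c1 * \<Delta>0 / ((c1 - 1) * \<gamma> * \<epsilon>\<^sup>2) = 2 * c1 * \<Delta>0 / ((c1 - 1) * \<epsilon>\<^sup>2) * (1 / \<gamma>)"
    by simp
  also have "\<dots> \<le> 2 * c1 * \<Delta>0 / ((c1 - 1) * \<epsilon>\<^sup>2) * (c2 * \<Lambda> / \<tau>)"
    using inv assms by (intro mult_left_mono) auto
  also have "\<dots> = 2 * C * (\<Delta>0 / \<epsilon>\<^sup>2 * \<Lambda>)" by (simp add: C_def mult_ac)
  finally have Y1: "2 * c1 * \<Delta>0 / ((c1 - 1) * \<gamma> * \<epsilon>\<^sup>2) \<le> 2 * C * (\<Delta>0 / \<epsilon>\<^sup>2 * \<Lambda>)" .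
  \<comment> \<open>Equivalent to \<open>\<tau> \<le> c1\<close>, which
    \<open>\<tau> \<le> 1 < c1\<close> provides.\<close>
  have c2C: "c2 / (c1 - 1) \<le> C"
  proof -
    have "c2 * ((c1 - 1) * \<tau>) \<le> c1 * c2 * (c1 - 1)"
    proof -
      have "c2 * (c1 - 1) * \<tau> \<le> c2 * (c1 - 1) * c1" using assms by (intro mult_left_mono) auto
      then show ?thesis by (simp add: mult_ac)
    qed
    then show ?thesis unfolding C_def using assms by (simp add: divide_simps mult_ac)
  qed
  have "1 / ((c1 - 1) * p) = 1 / (c1 - 1) * (1 / p)" by simp
  also have "\<dots> \<le> 1 / (c1 - 1) * (2 * c2 * T)" using p assms by (intro mult_left_mono) auto
  also have "\<dots> = 2 * (c2 / (c1 - 1)) * T" by simp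
  also have "\<dots> \<le> 2 * C * T" using c2C assms by (intro mult_right_mono mult_left_mono) auto
  finally have Y2: "1 / ((c1 - 1) * p) \<le> 2 * C * T" .
  have "1 \<le> c2 / (c1 - 1)" using assms by simp
  with c2C have "1 \<le> C" by linarith
  \<comment> \<open>\<open>C T \<ge> 1\<close> absorbs the rounding, so \<open>C T\<close> is
    counted 2 + 1 times and the other term twice; hence the factor 3.\<close>
  with assms have T1: "1 * 1 \<le> C * T" by (intro mult_mono) auto
  have "0 < c2 * \<Lambda>" "0 < c2" using den assms by linarith+
  then have "0 \<le> \<Lambda>" by (simp add: zero_less_mult_iff)
  then have "0 \<le> C * (\<Delta>0 / \<epsilon>\<^sup>2 * \<Lambda>)" using \<open>1 \<le> C\<close> assms by simp
  with Y1 Y2 T1 \<open>real K \<le> Y + 1\<close>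
  have "real K \<le> 3 * C * (T + \<Delta>0 / \<epsilon>\<^sup>2 * \<Lambda>)" unfolding Y_def distrib_left by linarith
  with \<open>K \<ge> 1\<close> bound show thesis unfolding C_def by (rule that)
qed

text \<open>The oracle and communication brackets are the iteration bracket times \<open>b'\<close>
  and times \<open>\<zeta>\<close>. Under a root the factor \<open>b'\<close> becomes
  \<open>b'\<^sup>2\<close>; one of the two joins \<open>R\<close>, the other stands beside
  \<open>\<omega>\<close> or cancels the \<open>b'\<close> in the denominator.\<close>

lemma batch_scaled_bounds:
  fixes L \<L> \<omega> \<Delta>0 \<epsilon> n b' R T d s \<zeta> :: real
  assumes "0 < n" "0 < b'" "0 < \<zeta>"
  defines "\<Lambda> \<equiv> L * (1 + sqrt (\<omega> / n * R)) + \<L> * sqrt ((1 + \<omega>) / (n * b') * R)"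
  shows "b' * (max (d / \<zeta>) (s / b') + \<Delta>0 / \<epsilon>\<^sup>2 * \<Lambda>) = max (d * b' / \<zeta>) s +
      \<Delta>0 * L * b' / \<epsilon>\<^sup>2 + \<Delta>0 * L / \<epsilon>\<^sup>2 * sqrt (\<omega> * b' / n * (b' * R)) +
      \<Delta>0 * \<L> / \<epsilon>\<^sup>2 * sqrt ((1 + \<omega>) / n * (b' * R))"
    and "\<zeta> * (max (d / \<zeta>) (s / b') + \<Delta>0 / \<epsilon>\<^sup>2 * \<Lambda>) =
      max d (s * \<zeta> / b') + \<Delta>0 * \<zeta> / \<epsilon>\<^sup>2 * \<Lambda>"
proof -
  have root: "sqrt (b'\<^sup>2 * v) = b' * sqrt v" for v
    using assms by (simp add: real_sqrt_mult)
  have "\<omega> * b' / n * (b' * R) = b'\<^sup>2 * (\<omega> / n * R)" by (simp add: power2_eq_square)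
  then have 1: "sqrt (\<omega> * b' / n * (b' * R)) = b' * sqrt (\<omega> / n * R)" by (simp only: root)
  have "(1 + \<omega>) / n * (b' * R) = b'\<^sup>2 * ((1 + \<omega>) / (n * b') * R)"
    using assms by (simp add: power2_eq_square divide_simps)
  then have 2: "sqrt ((1 + \<omega>) / n * (b' * R)) = b' * sqrt ((1 + \<omega>) / (n * b') * R)"
    by (simp only: root)
  have 3: "b' * max (d / \<zeta>) (s / b') = max (d * b' / \<zeta>) s"
    "\<zeta> * max (d / \<zeta>) (s / b') = max d (s * \<zeta> / b')"
    using assms by (auto simp: max_mult_distrib_left mult.commute)
  show "b' * (max (d / \<zeta>) (s / b') + \<Delta>0 / \<epsilon>\<^sup>2 * \<Lambda>) = max (d * b' / \<zeta>) s +
      \<Delta>0 * L * b' / \<epsilon>\<^sup>2 + \<Delta>0 * L / \<epsilon>\<^sup>2 * sqrt (\<omega> * b' / n * (b' * R)) +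
      \<Delta>0 * \<L> / \<epsilon>\<^sup>2 * sqrt ((1 + \<omega>) / n * (b' * R))"
    unfolding 1 2 distrib_left[of b'] 3 \<Lambda>_def
    by (simp add: distrib_left distrib_right add_divide_distrib mult_ac)
  show "\<zeta> * (max (d / \<zeta>) (s / b') + \<Delta>0 / \<epsilon>\<^sup>2 * \<Lambda>) =
      max d (s * \<zeta> / b') + \<Delta>0 * \<zeta> / \<epsilon>\<^sup>2 * \<Lambda>"
    unfolding distrib_left[of \<zeta>] 3 by simp
qed

text \<open>One number \<open>K\<close> serves all bounds. With
  \<open>C = c1 c2/((c1 - 1) \<tau>)\<close> and \<open>B\<close> the bracket of the iteration
  bound, \<open>K \<le> 3 C B\<close>. The oracle calls amount to at most \<open>1 + 3 * 3\<close>
  times \<open>C b' B\<close> and the communication to at most \<open>1 + 3 * 2\<close> times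
  \<open>C \<kappa> \<zeta> B\<close>, and 16 covers all of these.\<close>

theorem corollaryD3:
  fixes M :: "'m measure" and N :: "'q measure" and \<D> :: "nat \<Rightarrow> 'z measure"
    and n b b' :: nat
    and F :: "nat \<Rightarrow> 'z \<Rightarrow> real ^ 'd::finite \<Rightarrow> real"
    and fi :: "nat \<Rightarrow> real ^ 'd \<Rightarrow> real" and f :: "real ^ 'd \<Rightarrow> real"
    and Li \<L>i \<sigma>i :: "nat \<Rightarrow> real"
    and fstar L \<L> \<sigma> \<Delta>0 \<omega> \<zeta> d p \<epsilon> \<gamma> den R S c1 c2 \<tau> \<kappa> :: real
    and \<Q> :: "'q \<Rightarrow> real ^ 'd \<Rightarrow> real ^ 'd"
    and x0 :: "real ^ 'd"
    and \<xi> :: "nat \<Rightarrow> nat \<Rightarrow> nat \<Rightarrow> 'm \<Rightarrow> 'z" and c :: "nat \<Rightarrow> 'm \<Rightarrow> bool"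
    and q :: "nat \<Rightarrow> nat \<Rightarrow> 'm \<Rightarrow> 'q"
    and x g :: "nat \<Rightarrow> 'm \<Rightarrow> real ^ 'd" and gw \<Delta> :: "nat \<Rightarrow> nat \<Rightarrow> 'm \<Rightarrow> real ^ 'd"
    and cost :: "real ^ 'd \<Rightarrow> real"
  assumes sizes: "n \<ge> 1" "1 \<le> b'" "b' \<le> b" and eps: "\<epsilon> > 0"
    and data: "\<And>i. i < n \<Longrightarrow> prob_space (\<D> i)"
    and differentiable: "\<And>i z y. i < n \<Longrightarrow> z \<in> space (\<D> i) \<Longrightarrow> F i z differentiable (at y)"
    and fi: "\<And>i y. i < n \<Longrightarrow> has_bochner_integral (\<D> i) (\<lambda>z. F i z y) (fi i y)"
    and f: "\<And>y. f y = (1 / real n) * (\<Sum>i<n. fi i y)"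
    and lower_bound: "\<And>y. f y \<ge> fstar"
    and smooth: "\<And>i. i < n \<Longrightarrow> smooth (Li i) (fi i)"
    and unbiased: "\<And>i y. i < n \<Longrightarrow>
          has_bochner_integral (\<D> i) (\<lambda>z. grad (F i z) y) (grad (fi i) y)"
    and sigma_nonneg: "\<And>i. i < n \<Longrightarrow> \<sigma>i i \<ge> 0"
    and variance: "\<And>i y. i < n \<Longrightarrow>
          expectation_le (\<D> i) (\<lambda>z. (norm (grad (F i z) y - grad (fi i) y))\<^sup>2) ((\<sigma>i i)\<^sup>2)"
    and L: "L = sqrt ((1 / real n) * (\<Sum>i<n. (Li i)\<^sup>2))"
    and calL: "\<L> = sqrt ((1 / real n) * (\<Sum>i<n. (\<L>i i)\<^sup>2))"
    and sigma: "\<sigma> = sqrt ((1 / real n) * (\<Sum>i<n. (\<sigma>i i)\<^sup>2))"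
    and Delta0: "\<Delta>0 = f x0 - fstar"
    and quantizer: "quantization_operator N \<Q> \<omega>"
    and zeta: "\<zeta> = expected_density N \<Q>"
    and d: "d = real CARD('d)"
    and p: "p = min (\<zeta> / d) (real b' / (real b + real b'))"
    and sources: "independent_sources M n b \<D> N p \<xi> c q"
    and algorithm: "vr_marina_online n b b' \<gamma> x0 F \<Q> \<xi> c q x g gw \<Delta>"
    and average_smooth: "average_smooth M n b' fi x \<Delta> \<L>i"
    and batch_Theta: "c1 > 1"
          "c1 * (\<sigma>\<^sup>2 / (real n * \<epsilon>\<^sup>2)) \<le> real b" "real b \<le> c2 * (\<sigma>\<^sup>2 / (real n * \<epsilon>\<^sup>2))"
    and den: "den = L + sqrt (max (d / \<zeta> - 1) (real b / real b') / real n *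
                (\<omega> * L\<^sup>2 + (1 + \<omega>) * \<L>\<^sup>2 / real b'))"
    and stepsize: "\<gamma> > 0" "den > 0 \<Longrightarrow> \<gamma> \<le> 1 / den"
    and stepsize_ratio: "0 < \<tau>" "\<tau> \<le> 1" "den > 0 \<Longrightarrow> \<tau> / den \<le> \<gamma>"
    and cost: "\<kappa> > 0" "\<And>v. cost v = \<kappa> * real (nnz v)"
    and R: "R = max (d / \<zeta> - 1) (\<sigma>\<^sup>2 / (real n * real b' * \<epsilon>\<^sup>2))"
    and S: "S = max ((d / \<zeta> - 1) * real b') (\<sigma>\<^sup>2 / (real n * \<epsilon>\<^sup>2))"
  shows "\<exists>K\<ge>1.
      expectation_le (output_space M K) (\<lambda>o'. (norm (grad f (output_point x o')))\<^sup>2) (\<epsilon>\<^sup>2) \<and>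
      real K \<le> bigO_const c1 c2 \<tau> *
        (max (d / \<zeta>) (\<sigma>\<^sup>2 / (real n * real b' * \<epsilon>\<^sup>2)) +
         \<Delta>0 / \<epsilon>\<^sup>2 * (L * (1 + sqrt (\<omega> / real n * R)) +
                     \<L> * sqrt ((1 + \<omega>) / (real n * real b') * R))) \<and>
      expectation_le M (oracle_calls b b' c K)
        (bigO_const c1 c2 \<tau> *
          (max (d * real b' / \<zeta>) (\<sigma>\<^sup>2 / (real n * \<epsilon>\<^sup>2)) +
           \<Delta>0 * L * real b' / \<epsilon>\<^sup>2 +
           \<Delta>0 * L / \<epsilon>\<^sup>2 * sqrt (\<omega> * real b' / real n * S) +
           \<Delta>0 * \<L> / \<epsilon>\<^sup>2 * sqrt ((1 + \<omega>) / real n * S))) \<and>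
      (\<forall>i<n. expectation_le M (communication_cost cost \<Q> c q gw \<Delta> i K)
        (bigO_const c1 c2 \<tau> * \<kappa> *
          (max d (\<sigma>\<^sup>2 * \<zeta> / (real n * real b' * \<epsilon>\<^sup>2)) +
           \<Delta>0 * \<zeta> / \<epsilon>\<^sup>2 * (L * (1 + sqrt (\<omega> / real n * R)) +
                           \<L> * sqrt ((1 + \<omega>) / (real n * real b') * R)))))"
proof -
  define s where "s = \<sigma>\<^sup>2 / (real n * \<epsilon>\<^sup>2)"
  define C where "C = c1 * c2 / ((c1 - 1) * \<tau>)"
  define T where "T = max (d / \<zeta>) (s / real b')"
  define \<Lambda> where "\<Lambda> = L * (1 + sqrt (\<omega> / real n * R)) + \<L> * sqrt ((1 + \<omega>) / (real n * real b') * R)"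
  define B where "B = T + \<Delta>0 / \<epsilon>\<^sup>2 * \<Lambda>"
  have pos: "0 < real n" "0 < real b" "0 < real b'" using sizes by linarith+
  have s_b': "\<sigma>\<^sup>2 / (real n * real b' * \<epsilon>\<^sup>2) = s / real b'"
    "\<sigma>\<^sup>2 * \<zeta> / (real n * real b' * \<epsilon>\<^sup>2) = s * \<zeta> / real b'"
    by (simp_all add: s_def mult_ac)
  interpret Q: quantizer N \<Q> \<omega> by unfold_locales (rule quantizer)
  have \<zeta>: "0 < \<zeta>" "\<zeta> \<le> d"
    unfolding zeta d by (rule Q.expected_density_pos Q.expected_density_le)+
  then have d_pos: "0 < d" by linarith
  note prob = min_probability[OF \<zeta>(1) d_pos pos(2,3), folded p]
  have "prob_space M" using sources unfolding independent_sources_def by blast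
  interpret run: vr_marina_run M N \<Q> \<omega> \<D> n b b' F fi Li \<L>i \<sigma>i p \<gamma> x0 \<xi> c q x g gw \<Delta>
  proof (intro vr_marina_run.intro vr_marina_run_axioms.intro)
    show "(\<lambda>z. F i z y) \<in> borel_measurable (\<D> i)" if "i < n" for i y
      using fi[OF that] by (rule borel_measurable_has_bochner_integral)
    show "quantizer N \<Q> \<omega>" ..
    show "0 \<le> p" using prob(1) by simp
  qed (fact \<open>prob_space M\<close> sizes data differentiable smooth unbiased variance prob(2)
      sources algorithm average_smooth)+

  have "0 \<le> s" by (simp add: s_def)
  moreover have s_b: "c1 * s \<le> real b" "real b \<le> c2 * s" using batch_Theta by (simp_all add: s_def)
  \<comment> \<open>\<open>s = 0\<close> would force \<open>b = 0\<close> through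
    \<open>b \<le> c2 s\<close>, against \<open>b \<ge> 1\<close>.\<close>
  ultimately have s_pos: "0 < s" using pos(2) by (cases "s = 0") auto
  have "c1 * s \<le> c2 * s" using s_b by linarith
  then have c12: "c1 \<le> c2" using s_pos by (simp add: mult_le_cancel_right)
  have C_ge: "1 \<le> C" "c2 \<le> C"
  proof -
    have "(c1 - 1) * \<tau> \<le> c1 * 1" using batch_Theta(1) stepsize_ratio by (intro mult_mono) auto
    then have "c2 * ((c1 - 1) * \<tau>) \<le> c2 * c1" using c12 batch_Theta(1) by (intro mult_left_mono) auto
    moreover have "0 < (c1 - 1) * \<tau>" using batch_Theta(1) stepsize_ratio by simp
    ultimately show "c2 \<le> C" unfolding C_def by (simp add: pos_le_divide_eq mult.commute)
    then show "1 \<le> C" using c12 batch_Theta(1) by linarith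
  qed
  have nonneg: "0 \<le> L" "0 \<le> \<L>" by (simp_all add: L calL sum_nonneg)
  have \<Delta>0: "0 \<le> \<Delta>0" using lower_bound[of x0] by (simp add: Delta0)
  have "1 \<le> d / \<zeta>" using \<zeta> by (simp add: pos_le_divide_eq)
  then have T: "1 \<le> T" by (simp add: T_def le_max_iff_disj)
  have R_eq: "R = max (d / \<zeta> - 1) (s / real b')" by (simp add: R s_b')
  have S_eq: "S = real b' * R"
    using pos by (simp add: S R_eq s_def[symmetric] max_mult_distrib_left mult.commute)
  have R_nonneg: "0 \<le> R" using \<open>1 \<le> d / \<zeta>\<close> by (simp add: R_eq le_max_iff_disj)
  have \<Lambda>_nonneg: "0 \<le> \<Lambda>" using nonneg R_nonneg Q.omega_pos by (simp add: \<Lambda>_def)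

  have smooth_f: "smooth L f" and grad_f: "\<And>y. grad f y = run.mean_grad y"
    unfolding L run.mean_grad_def by (rule smooth_average[OF sizes(1) f smooth]; assumption)+
  have \<eta>: "run.noise_level = \<sigma>\<^sup>2 / (real n * real b)"
    by (simp add: run.noise_level_def sigma sum_nonneg)
  have noise: "run.noise_level \<le> \<epsilon>\<^sup>2 / c1"
  proof -
    have "c1 * \<sigma>\<^sup>2 \<le> real b * (real n * \<epsilon>\<^sup>2)"
      using batch_Theta(2) pos eps by (simp add: pos_divide_le_eq)
    then show ?thesis
      unfolding \<eta> using pos batch_Theta(1) by (simp add: divide_simps mult_ac)
  qed
  \<comment> \<open>The weight of \<open>\<gamma>\<^sup>2\<close> in the stepsize condition, to be
    identified with the expression under the root in \<open>den\<close>.\<close>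
  define X where "X = (1 - p) / p * run.step_factor"
  have X: "X = max (d / \<zeta> - 1) (real b / real b') / real n *
      (\<omega> * L\<^sup>2 + (1 + \<omega>) * \<L>\<^sup>2 / real b')"
  proof -
    have "(1 / real n) * (\<Sum>i<n. \<omega> * (Li i)\<^sup>2 + (1 + \<omega>) * (\<L>i i)\<^sup>2 / real b') =
        \<omega> * L\<^sup>2 + (1 + \<omega>) * \<L>\<^sup>2 / real b'"
      by (simp add: L calL sum_nonneg sum.distrib sum_distrib_left[symmetric]
          sum_divide_distrib[symmetric] add_divide_distrib mult.commute)
    moreover have "run.step_factor = (1 / real n) *
        ((1 / real n) * (\<Sum>i<n. \<omega> * (Li i)\<^sup>2 + (1 + \<omega>) * (\<L>i i)\<^sup>2 / real b'))"
      by (simp add: run.step_factor_def power2_eq_square)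
    ultimately have "run.step_factor = (1 / real n) * (\<omega> * L\<^sup>2 + (1 + \<omega>) * \<L>\<^sup>2 / real b')"
      by simp
    then show ?thesis unfolding X_def prob(4) by simp
  qed
  have X_nonneg: "0 \<le> X"
    unfolding X using Q.omega_pos pos by (simp add: le_max_iff_disj)
  have den': "den = L + sqrt X" by (simp add: den X)

  obtain K where K: "K \<ge> 1" "real K \<le> 3 * C * B"
    and grad_sum: "(\<Sum>k<K. second_moment M (\<lambda>w. grad f (x k w))) \<le> real K * \<epsilon>\<^sup>2"
  proof (cases "den > 0")
    case True
    have "0 \<le> s / real b'" using s_pos by simp
    have b_le: "real b / real b' \<le> c2 * (s / real b')"
      using s_b(2) pos by (simp add: divide_right_mono)
    have "max (d / \<zeta> - 1) (real b / real b') \<le> c2 * R"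
    proof (rule max.boundedI)
      have "1 * (d / \<zeta> - 1) \<le> c2 * R"
        using c12 batch_Theta(1) \<open>1 \<le> d / \<zeta>\<close> by (intro mult_mono) (auto simp: R_eq)
      then show "d / \<zeta> - 1 \<le> c2 * R" by simp
      have "c2 * (s / real b') \<le> c2 * R"
        using c12 batch_Theta(1) by (intro mult_left_mono) (auto simp: R_eq)
      with b_le show "real b / real b' \<le> c2 * R" by linarith
    qed
    then have den_le: "den \<le> c2 * \<Lambda>"
      unfolding den \<Lambda>_def using nonneg Q.omega_pos pos c12 batch_Theta(1) R_nonneg
      by (intro stepsize_denominator_le) auto
    have inv_p: "1 / p \<le> 2 * c2 * T"
      unfolding prob(3)
    proof (rule max.boundedI)
      have "1 * (d / \<zeta>) \<le> 2 * c2 * T"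
        using c12 batch_Theta(1) \<open>1 \<le> d / \<zeta>\<close> by (intro mult_mono) (auto simp: T_def)
      then show "d / \<zeta> \<le> 2 * c2 * T" by simp
      \<comment> \<open>From \<open>b' \<le> b\<close>: the summand 1 in \<open>1 + b/b'\<close> is
        charged to \<open>b/b'\<close>, whence the factor 2.\<close>
      have "1 \<le> real b / real b'" using sizes pos by simp
      then have "1 + real b / real b' \<le> 2 * (c2 * (s / real b'))" using b_le by linarith
      also have "\<dots> \<le> 2 * (c2 * T)"
        using c12 batch_Theta(1) by (intro mult_left_mono) (auto simp: T_def)
      finally show "1 + real b / real b' \<le> 2 * c2 * T" by simp
    qed
    obtain K where K: "K \<ge> 1"
      "2 * \<Delta>0 / \<gamma> + run.noise_level / p + real K * run.noise_level \<le> real K * \<epsilon>\<^sup>2"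
      "real K \<le> 3 * (c1 * c2 / ((c1 - 1) * \<tau>)) * (T + \<Delta>0 / \<epsilon>\<^sup>2 * \<Lambda>)"
      using iteration_count[OF batch_Theta(1) c12 stepsize_ratio(1,2) stepsize(1) eps prob(1) \<Delta>0 T
          inv_p stepsize_ratio(3)[OF True] True den_le noise] .
    have "\<gamma> * den \<le> 1" using stepsize(2)[OF True] True by (simp add: pos_le_divide_eq)
    then have "L * \<gamma> + X * \<gamma>\<^sup>2 \<le> 1"
      unfolding den' by (rule stepsize_condition[OF nonneg(1) X_nonneg stepsize(1)])
    then have "(\<Sum>k<K. second_moment M (\<lambda>w. grad f (x k w))) \<le>
        2 * (f x0 - fstar) / \<gamma> + run.noise_level / p + real K * run.noise_level"
      unfolding X_def by (rule run.gradient_bound[OF smooth_f grad_f lower_bound stepsize(1) _ prob(1)])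
    with K(2) have "(\<Sum>k<K. second_moment M (\<lambda>w. grad f (x k w))) \<le> real K * \<epsilon>\<^sup>2"
      by (simp add: Delta0)
    with K(1,3) show thesis by (intro that) (simp_all add: C_def B_def)
  next
    \<comment> \<open>\<open>den\<close> is a sum of nonnegative terms, so here
      \<open>L = 0\<close>; the gradient vanishes identically and one iteration is enough.\<close>
    case False
    with nonneg X_nonneg have "L = 0" unfolding den'
      by (smt (verit) real_sqrt_ge_zero)
    then have "grad f y = 0" for y
      using smooth_f lower_bound smooth_zero_bounded_below by blast
    then have "(\<Sum>k<1. second_moment M (\<lambda>w. grad f (x k w))) \<le> real 1 * \<epsilon>\<^sup>2"
      by (simp add: second_moment_def)
    moreover have "1 * 1 \<le> C * B"
    proof (rule mult_mono)
      have "0 \<le> \<Delta>0 / \<epsilon>\<^sup>2 * \<Lambda>" using \<Delta>0 \<Lambda>_nonneg by simp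
      with T show "1 \<le> B" unfolding B_def by linarith
    qed (use C_ge in auto)
    then have "real 1 \<le> 3 * C * B" by simp
    ultimately show thesis using that[of 1] by blast
  qed

  have B: "T \<le> B" using \<Delta>0 \<Lambda>_nonneg by (simp add: B_def)
  have CB_nonneg: "0 \<le> C * B" using C_ge B T by simp
  then have CB3_nonneg: "0 \<le> 3 * C * B" by linarith
  have const: "bigO_const c1 c2 \<tau> = 16 * C" by (simp add: bigO_const_def C_def)
  have scaled:
    "real b' * B = max (d * real b' / \<zeta>) s +
      \<Delta>0 * L * real b' / \<epsilon>\<^sup>2 + \<Delta>0 * L / \<epsilon>\<^sup>2 * sqrt (\<omega> * real b' / real n * S) +
      \<Delta>0 * \<L> / \<epsilon>\<^sup>2 * sqrt ((1 + \<omega>) / real n * S)"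
    "\<zeta> * B = max d (s * \<zeta> / real b') + \<Delta>0 * \<zeta> / \<epsilon>\<^sup>2 * \<Lambda>"
    unfolding B_def T_def \<Lambda>_def S_eq
    by (rule batch_scaled_bounds[OF pos(1,3) \<zeta>(1)])+

  have "expectation_le (output_space M K) (\<lambda>o'. (norm (grad f (output_point x o')))\<^sup>2) (\<epsilon>\<^sup>2)"
  proof (rule run.output_expectation[OF K(1)])
    show "(\<lambda>y. (norm (grad f y))\<^sup>2) \<in> borel_measurable borel"
      using smooth_borel_measurable_grad[OF smooth_f] by measurable
    show "integrable M (\<lambda>w. (norm (grad f (x k w)))\<^sup>2)" for k
      unfolding grad_f using run.mean_grad_square_integrable by (rule square_integrableD)
    show "(\<Sum>k<K. \<integral>w. (norm (grad f (x k w)))\<^sup>2 \<partial>M) \<le> real K * \<epsilon>\<^sup>2"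
      using grad_sum unfolding second_moment_def .
  qed simp
  moreover have "real K \<le> bigO_const c1 c2 \<tau> * B"
    using K(2) CB_nonneg unfolding const by linarith
  moreover have "expectation_le M (oracle_calls b b' c K) (bigO_const c1 c2 \<tau> * (real b' * B))"
  proof -
    have "p * real b + (1 - p) * (2 * real b') \<le> 3 * real b'"
    proof -
      have "(1 - p) * (2 * real b') \<le> 1 * (2 * real b')"
        using prob(1) by (intro mult_right_mono) auto
      with prob(6) show ?thesis by linarith
    qed
    then have "real K * (p * real b + (1 - p) * (2 * real b')) \<le> (3 * C * B) * (3 * real b')"
      by (rule mult_mono[OF K(2) _ CB3_nonneg]) (use prob pos in simp_all)
    \<comment> \<open>The initial minibatch is charged to the term \<open>s/b'\<close> inside
      \<open>T\<close>.\<close>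
    moreover have "real b \<le> C * (real b' * B)"
    proof -
      have "s / real b' \<le> B" using B by (simp add: T_def)
      then have "s \<le> real b' * B" using pos by (simp add: pos_divide_le_eq mult.commute)
      then have "c2 * s \<le> C * (real b' * B)"
        using C_ge s_pos by (intro mult_mono) auto
      with s_b(2) show ?thesis by linarith
    qed
    moreover have "0 \<le> real b' * (C * B)" using CB_nonneg by simp
    ultimately have "real b + real K * (p * real b + (1 - p) * (2 * real b')) \<le> 16 * C * (real b' * B)"
      by (simp add: mult_ac)
    with run.oracle_calls_le[of K] show ?thesis
      unfolding const expectation_le_def by linarith
  qed
  moreover have "expectation_le M (communication_cost cost \<Q> c q gw \<Delta> i K)
      (bigO_const c1 c2 \<tau> * \<kappa> * (\<zeta> * B))" if i: "i < n" for i
  proof -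
    have "(1 - p) * \<zeta> \<le> 1 * \<zeta>" using prob(1) \<zeta> by (intro mult_right_mono) auto
    with prob(5) have "p * d + (1 - p) * \<zeta> \<le> 2 * \<zeta>" by linarith
    then have "real K * (p * d + (1 - p) * \<zeta>) \<le> (3 * C * B) * (2 * \<zeta>)"
      by (rule mult_mono[OF K(2) _ CB3_nonneg]) (use prob \<zeta> d_pos in simp_all)
    \<comment> \<open>The uncompressed initial vector is charged to the term
      \<open>d/\<zeta>\<close> inside \<open>T\<close>.\<close>
    moreover have "d \<le> C * (\<zeta> * B)"
    proof -
      have "d / \<zeta> \<le> B" using B by (simp add: T_def)
      then have "d \<le> \<zeta> * B" using \<zeta> by (simp add: pos_divide_le_eq mult.commute)
      then have "1 * d \<le> C * (\<zeta> * B)" using C_ge d_pos by (intro mult_mono) auto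
      then show ?thesis by simp
    qed
    moreover have "0 \<le> \<zeta> * (C * B)" using CB_nonneg \<zeta> by simp
    ultimately have "d + real K * (p * d + (1 - p) * \<zeta>) \<le> 16 * C * (\<zeta> * B)"
      by (simp add: mult_ac)
    then have "\<kappa> * (d + real K * (p * d + (1 - p) * \<zeta>)) \<le> \<kappa> * (16 * C * (\<zeta> * B))"
      using cost(1) by (intro mult_left_mono) auto
    with run.communication_cost_le[OF i cost, of K] show ?thesis
      unfolding const expectation_le_def d[symmetric] zeta[symmetric] by (simp add: mult_ac)
  qed
  ultimately show ?thesis
    unfolding scaled s_b' s_def[symmetric] \<Lambda>_def[symmetric] T_def[symmetric] B_def[symmetric]
    using K(1) by blast
qed

end
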